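(* Let $q=2^{2e+1}>2$, let $V$ and $\mathrm{Sz}(q)\le\mathrm{Sym}(V)$ be as in the context, and let $G$ be any subgroup of $\mathrm{Sym}(V)$ containing $\mathrm{Sz}(q)$ as a normal subgroup. Suppose that $P$ is a nontrivial imprimitive block of $G_\infty$ on $V\setminus\{\infty\}$ containing $\mathbf 0=(0,0,0)$. Then: (a) $P=\{(0,\eta,\eta^\sigma)\in V:\eta\in\mathbb F_q\}$ and $\mathrm{Sz}(q)_{\infty,P}=\langle t_{0,\xi},n_\kappa:\kappa\in\mathbb F_q^\times,\xi\in\mathbb F_q\rangle$; (b) setting $L:=P\cup\{\infty\}$, $\mathcal D:=(V,L^{\mathrm{Sz}(q)})=(V,L^G)$ is a $2$-$(q^2+1,q+1,q+1)$ design admitting $G$ as a $2$-point-transitive and block-transitive group of automorphisms, and $\Omega:=(\infty,L)^{\mathrm{Sz}(q)}=(\infty,L)^G$ is a 1-feasible $G$-orbit on the flag set of $\mathcal D$; moreover, the $G$-flag graph of $\mathcal D$ with respect to $(\Omega,\Xi)$ is the same as the $\mathrm{Sz}(q)$-flag graph $\Gamma(\mathcal D,\Omega,\Xi)$; (c) $\Gamma(\mathcal D,\Omega,\Xi)$ is connected with order $|\Omega|=q(q^2+1)$ and valency $q$.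
   Context: Groups act on the right. $G_x$ is a point stabilizer, $G_{x,P}$ the setwise stabilizer of $P$ in $G_x$. For a transitive group $X$ on $\Delta$, an imprimitive block is a nonempty $P\subseteq\Delta$ with $P^g=P$ or $P^g\cap P=\emptyset$ for all $g\in X$; it is nontrivial if $1<|P|<|\Delta|$. Suzuki group: $\sigma:\xi\mapsto\xi^{2^{e+1}}$ is an automorphism of $\mathbb F_q$, and $V=\{(\eta_1,\eta_2,\eta_3)\in\mathbb F_q^3:\eta_3=\eta_1\eta_2+\eta_1^{\sigma+2}+\eta_2^\sigma\}\cup\{\infty\}$. For $\alpha,\beta,\kappa\in\mathbb F_q$, $\kappa\neq0$, the permutations $t_{\alpha,\beta}$ and $n_\kappa$ of $V$ fix $\infty$ and satisfy $t_{\alpha,\beta}:(\eta_1,\eta_2,\eta_3)\mapsto(\eta_1+\alpha,\eta_2+\beta+\alpha^\sigma\eta_1,\mu)$ with $\mu=\eta_3+\alpha\beta+\alpha^{\sigma+2}+\beta^\sigma+\alpha\eta_2+\alpha^{\sigma+1}\eta_1+\beta\eta_1$, and $n_\kappa:(\eta_1,\eta_2,\eta_3)\mapsto(\kappa\eta_1,\kappa^{\sigma+1}\eta_2,\kappa^{\sigma+2}\eta_3)$. The involution $w$ is $(\eta_1,\eta_2,\eta_3)\leftrightarrow(\eta_2/\eta_3,\eta_1/\eta_3,1/\eta_3)$ for $\eta_3\ne0$, $\infty\leftrightarrow(0,0,0)$. $\mathrm{Sz}(q)$ is the group generated by $w$ and all $t_{\alpha,\beta}$, $n_\kappa$. Designs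 and flag graphs: $(V,L^G)$ is the incidence structure with point set $V$, block set $\{L^g:g\in G\}$ and incidence given by inclusion. A flag is a pair $(x,L)$ with $L$ a block, $x\in L$. For a $G$-orbit $\Omega$ on flags, $\Omega(x)$ is the set of flags in $\Omega$ with point entry $x$; $\Omega$ is 1-feasible if (i) $|\Omega(x)|\ge2$; (ii) for some (hence all) $(x,L)\in\Omega$, $G_{x,L}$ is transitive on $L\setminus\{x\}$; (iii) $L\cap N=\{x\}$ for distinct $(x,L),(x,N)\in\Omega(x)$. $\Xi=\Xi(\mathcal D,\Omega)$ is the set of $((x,L),(y,N))\in\Omega\times\Omega$ with $x\ne y$ and $x,y\in L\cap N$ (a self-paired $G$-orbit when $\Omega$ is 1-feasible and $G$ is 2-transitive on points). The $G$-flag graph $\Gamma(\mathcal D,\Omega,\Xi)$ has vertex set $\Omega$ and arc set $\Xi$. *)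

theory Defs
  imports
    "HOL-Algebra.Group_Action"
    "HOL-Algebra.Generated_Groups"
    "Graph_Theory.Pair_Digraph"
    "Graph_Theory.Digraph_Component"
begin

section \<open>Permutation groups\<close>

text \<open>
  A permutation group on \<open>V\<close> is a subgroup of \<^term>\<open>BijGroup V\<close>, and \<open>g x\<close> stands for the
  right-action notation \<open>x\<^sup>g\<close>. The product of \<^term>\<open>BijGroup V\<close> is \<open>x \<mapsto> g (f x)\<close>, the opposite of
  the one belonging to right actions; orbits, stabilizers, generated subgroups and normality are
  the same for both products.
\<close>

abbreviation perm_group :: "'v set \<Rightarrow> ('v \<Rightarrow> 'v) set \<Rightarrow> ('v \<Rightarrow> 'v) monoid" where
  "perm_group V G \<equiv> BijGroup V\<lparr>carrier := G\<rparr>"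

definition point_stabilizer :: "('v \<Rightarrow> 'v) monoid \<Rightarrow> 'v \<Rightarrow> ('v \<Rightarrow> 'v) set" where
  "point_stabilizer X x = stabilizer X (\<lambda>g. g) x"

definition point_set_stabilizer ::
    "('v \<Rightarrow> 'v) monoid \<Rightarrow> 'v \<Rightarrow> 'v set \<Rightarrow> ('v \<Rightarrow> 'v) set" where
  "point_set_stabilizer X x P = point_stabilizer X x \<inter> stabilizer X (\<lambda>g S. g ` S) P"

definition transitive_on :: "('v \<Rightarrow> 'v) set \<Rightarrow> 'v set \<Rightarrow> bool" where
  "transitive_on H S \<longleftrightarrow> (\<forall>x\<in>S. \<forall>y\<in>S. \<exists>g\<in>H. g x = y)"

definition two_transitive_on :: "('v \<Rightarrow> 'v) set \<Rightarrow> 'v set \<Rightarrow> bool" where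
  "two_transitive_on H S \<longleftrightarrow>
     (\<forall>x\<in>S. \<forall>y\<in>S. \<forall>x'\<in>S. \<forall>y'\<in>S. x \<noteq> y \<longrightarrow> x' \<noteq> y' \<longrightarrow> (\<exists>g\<in>H. g x = x' \<and> g y = y'))"

definition imprimitive_block :: "('v \<Rightarrow> 'v) set \<Rightarrow> 'v set \<Rightarrow> 'v set \<Rightarrow> bool" where
  "imprimitive_block H S P \<longleftrightarrow>
     P \<noteq> {} \<and> P \<subseteq> S \<and> (\<forall>g\<in>H. g ` P = P \<or> g ` P \<inter> P = {})"

definition nontrivial_imprimitive_block :: "('v \<Rightarrow> 'v) set \<Rightarrow> 'v set \<Rightarrow> 'v set \<Rightarrow> bool" where
  "nontrivial_imprimitive_block H S P \<longleftrightarrow>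
     imprimitive_block H S P \<and> 1 < card P \<and> card P < card S"


section \<open>Suzuki groups\<close>

text \<open>
  Throughout, \<^typ>\<open>'a\<close> is the field with \<open>q = 2 ^ (2 * e + 1)\<close> elements, so the exponents
  \<open>\<sigma> + 1\<close> and \<open>\<sigma> + 2\<close> denote \<open>\<xi>\<^sup>\<sigma> \<xi>\<close> and \<open>\<xi>\<^sup>\<sigma> \<xi>\<^sup>2\<close>.
\<close>

datatype 'a sz_point = Infty | Aff 'a 'a 'a

definition sig :: "nat \<Rightarrow> 'a::field \<Rightarrow> 'a" where
  "sig e \<xi> = \<xi> ^ (2 ^ (e + 1))"

definition sz_points :: "nat \<Rightarrow> 'a::field sz_point set" where
  "sz_points e =
     {Aff x1 x2 x3 | x1 x2 x3. x3 = x1 * x2 + sig e x1 * x1^2 + sig e x2} \<union> {Infty}"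

definition sz_t :: "nat \<Rightarrow> 'a::field \<Rightarrow> 'a \<Rightarrow> 'a sz_point \<Rightarrow> 'a sz_point" where
  "sz_t e \<alpha> \<beta> = (\<lambda>p\<in>sz_points e. case p of
       Infty \<Rightarrow> Infty
     | Aff x1 x2 x3 \<Rightarrow>
         Aff (x1 + \<alpha>)
             (x2 + \<beta> + sig e \<alpha> * x1)
             (x3 + \<alpha> * \<beta> + sig e \<alpha> * \<alpha>^2 + sig e \<beta> + \<alpha> * x2 + sig e \<alpha> * \<alpha> * x1 + \<beta> * x1))"

definition sz_n :: "nat \<Rightarrow> 'a::field \<Rightarrow> 'a sz_point \<Rightarrow> 'a sz_point" where
  "sz_n e \<kappa> = (\<lambda>p\<in>sz_points e. case p of
       Infty \<Rightarrow> Infty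
     | Aff x1 x2 x3 \<Rightarrow> Aff (\<kappa> * x1) (sig e \<kappa> * \<kappa> * x2) (sig e \<kappa> * \<kappa>^2 * x3))"

text \<open>The only affine point of \<^term>\<open>sz_points e\<close> with third coordinate \<open>0\<close> is \<open>(0, 0, 0)\<close>.\<close>

definition sz_w :: "nat \<Rightarrow> 'a::field sz_point \<Rightarrow> 'a sz_point" where
  "sz_w e = (\<lambda>p\<in>sz_points e. case p of
       Infty \<Rightarrow> Aff 0 0 0
     | Aff x1 x2 x3 \<Rightarrow> if x3 = 0 then Infty else Aff (x2 / x3) (x1 / x3) (1 / x3))"

definition suzuki :: "nat \<Rightarrow> ('a::field sz_point \<Rightarrow> 'a sz_point) set" where
  "suzuki e = generate (BijGroup (sz_points e))
     ({sz_w e} \<union> {sz_t e \<alpha> \<beta> | \<alpha> \<beta>. True} \<union> {sz_n e \<kappa> | \<kappa>. \<kappa> \<noteq> 0})"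


section \<open>Designs and flag graphs\<close>

record 'v incidence_structure =
  points :: "'v set"
  blocks :: "'v set set"

definition two_design :: "'v incidence_structure \<Rightarrow> nat \<Rightarrow> nat \<Rightarrow> nat \<Rightarrow> bool" where
  "two_design D v k l \<longleftrightarrow>
     finite (points D) \<and> card (points D) = v \<and>
     (\<forall>B\<in>blocks D. B \<subseteq> points D \<and> card B = k) \<and>
     (\<forall>x\<in>points D. \<forall>y\<in>points D. x \<noteq> y \<longrightarrow> card {B \<in> blocks D. x \<in> B \<and> y \<in> B} = l)"

definition automorphisms :: "'v incidence_structure \<Rightarrow> ('v \<Rightarrow> 'v) set" where
  "automorphisms D = {g \<in> Bij (points D). (\<lambda>B. g ` B) ` blocks D = blocks D}"

definition block_transitive :: "('v \<Rightarrow> 'v) set \<Rightarrow> 'v incidence_structure \<Rightarrow> bool" where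
  "block_transitive H D \<longleftrightarrow> (\<forall>B\<in>blocks D. \<forall>C\<in>blocks D. \<exists>g\<in>H. g ` B = C)"

type_synonym 'v flag = "'v \<times> 'v set"

definition flags :: "'v incidence_structure \<Rightarrow> 'v flag set" where
  "flags D = {(x, L). L \<in> blocks D \<and> x \<in> L}"

definition flag_act :: "('v \<Rightarrow> 'v) \<Rightarrow> 'v flag \<Rightarrow> 'v flag" where
  "flag_act g = (\<lambda>(x, L). (g x, g ` L))"

definition flag_pair_act :: "('v \<Rightarrow> 'v) \<Rightarrow> 'v flag \<times> 'v flag \<Rightarrow> 'v flag \<times> 'v flag" where
  "flag_pair_act g = (\<lambda>(f, f'). (flag_act g f, flag_act g f'))"

definition flags_at :: "'v flag set \<Rightarrow> 'v \<Rightarrow> 'v flag set" where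
  "flags_at \<Omega> x = {f \<in> \<Omega>. fst f = x}"

definition one_feasible ::
    "('v \<Rightarrow> 'v) monoid \<Rightarrow> 'v incidence_structure \<Rightarrow> 'v flag set \<Rightarrow> bool" where
  "one_feasible X D \<Omega> \<longleftrightarrow>
     \<Omega> \<in> orbits X (flags D) flag_act \<and>
     (\<forall>x\<in>points D. card (flags_at \<Omega> x) \<ge> 2) \<and>
     (\<forall>(x, L)\<in>\<Omega>. transitive_on (point_set_stabilizer X x L) (L - {x})) \<and>
     (\<forall>x L N. (x, L) \<in> \<Omega> \<longrightarrow> (x, N) \<in> \<Omega> \<longrightarrow> L \<noteq> N \<longrightarrow> L \<inter> N = {x})"

definition Xi :: "'v flag set \<Rightarrow> 'v flag rel" where
  "Xi \<Omega> = {((x, L), (y, N)) | x L y N.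
     (x, L) \<in> \<Omega> \<and> (y, N) \<in> \<Omega> \<and> x \<noteq> y \<and> x \<in> L \<inter> N \<and> y \<in> L \<inter> N}"

text \<open>
  \<open>is_flag_graph X D \<Omega> \<Xi> \<Gamma>\<close> states that the \<open>X\<close>-flag graph of \<open>D\<close> with respect to \<open>(\<Omega>, \<Xi>)\<close>
  is defined and equals \<open>\<Gamma>\<close>. The dependence on \<open>X\<close> lies in the requirements that \<open>\<Omega>\<close> be a
  1-feasible \<open>X\<close>-orbit on flags and \<open>\<Xi>\<close> a self-paired \<open>X\<close>-orbit on pairs of flags in \<open>\<Omega>\<close>.
\<close>

definition is_flag_graph ::
    "('v \<Rightarrow> 'v) monoid \<Rightarrow> 'v incidence_structure \<Rightarrow> 'v flag set \<Rightarrow> 'v flag rel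
      \<Rightarrow> 'v flag pair_pre_digraph \<Rightarrow> bool" where
  "is_flag_graph X D \<Omega> \<Xi> \<Gamma> \<longleftrightarrow>
     one_feasible X D \<Omega> \<and>
     \<Xi> = Xi \<Omega> \<and> \<Xi> \<in> orbits X (\<Omega> \<times> \<Omega>) flag_pair_act \<and> sym \<Xi> \<and>
     \<Gamma> = \<lparr>pverts = \<Omega>, parcs = \<Xi>\<rparr>"

text \<open>Every edge of an undirected graph is a pair of opposite arcs, so valency is out-degree.\<close>

definition has_valency :: "'v pair_pre_digraph \<Rightarrow> nat \<Rightarrow> bool" where
  "has_valency \<Gamma> d \<longleftrightarrow> pair_graph \<Gamma> \<and> (\<forall>u\<in>pverts \<Gamma>. out_degree (with_proj \<Gamma>) u = d)"

end

theory Submission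
  imports Defs
begin

text \<open>
  Affine points are addressed by their first two coordinates, \<open>pt x y\<close>. The translations \<open>T a b\<close>
  act regularly on them, and \<open>L = {\<infinity>} \<union> {pt 0 y}\<close> is the section of the Suzuki ovoid by a plane.

  \<^bold>\<open>The block.\<close> A block \<open>P\<close> of the stabilizer of \<open>\<infinity>\<close> that contains \<open>pt 0 0\<close> is closed under
  \<open>T a b\<close> whenever \<open>pt a b \<in> P\<close>, and under all scalings \<open>M k\<close>. A translation with \<open>a \<noteq> 0\<close> has
  a nontrivial square of the form \<open>T 0 b\<close>, and \<open>k \<mapsto> \<sigma> k * k\<close> is onto, so a single point off the
  axis \<open>{pt 0 y}\<close> in \<open>P\<close> forces \<open>P\<close> to contain every affine point, and otherwise a single nonzero
  point fills the axis (\<open>block_is_axis\<close>).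

  \<^bold>\<open>Size of the Suzuki group.\<close> Most of the remaining statements need an upper bound on the group,
  namely that the elements fixing both \<open>\<infinity>\<close> and \<open>pt 0 0\<close> are the scalings (\<open>two_point_stabilizer\<close>).
  Instead of a Bruhat decomposition, the proof uses that the group preserves the alternating
  form of the ambient projective 3-space up to rescaling the vector of each point. A
  permutation with this property that fixes \<open>\<infinity>\<close> and \<open>pt 0 0\<close> acts linearly on the first two
  coordinates, and the equation of the ovoid forces it to be a scaling.

  \<^bold>\<open>The design.\<close> It follows that the flags of \<open>\<Omega>\<close> at \<open>\<infinity>\<close> are the \<open>q\<close> sets
  \<open>{\<infinity>} \<union> {pt a y | y}\<close>, which partition the affine points. By 2-transitivity, for any two points
  \<open>x \<noteq> y\<close> there is exactly one flag of \<open>\<Omega>\<close> at \<open>x\<close> whose block contains \<open>y\<close>. Moreover a block occurs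
  in only one flag (\<open>flag_point_unique\<close>), so there are \<open>q (q\<^sup>2 + 1)\<close> blocks, and double counting of
  incident point pairs gives \<open>\<lambda> = q + 1\<close>.

  \<^bold>\<open>From the Suzuki group to \<open>G\<close>.\<close> An element of \<open>G\<close> agrees on \<open>\<infinity>\<close> and \<open>pt 0 0\<close> with an element of
  the Suzuki group; their quotient fixes \<open>\<infinity>\<close> and a point of the block \<open>P\<close>, hence fixes \<open>L\<close>. Thus
  both groups have the same orbit of \<open>(\<infinity>, L)\<close>, and the same flag graph.

  \<^bold>\<open>Connectedness.\<close> The component of \<open>(\<infinity>, L)\<close> is invariant under \<open>T 0 b\<close>, \<open>M k\<close> and \<open>w\<close>, which
  already generate a group transitive on points. If the component has two flags at some point,
  the scalings show that it has all of them. Otherwise every point \<open>x\<close> has a unique block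
  \<open>N\<^sub>x\<close> in the component, and \<open>y \<in> N\<^sub>x - {x}\<close> defines a graph of valency \<open>q\<close> on the \<open>q\<^sup>2 + 1\<close> points
  with neither triangles nor quadrangles, that is, a Moore graph of diameter 2. The translations
  \<open>T 0 b\<close> are automorphisms of it, which for \<open>q > 2\<close> is excluded by an elementary pigeonhole
  argument (\<open>no_Moore_relation\<close>).
\<close>

section \<open>The field and its automorphism \<open>\<sigma>\<close>\<close>

lemma finite_field_power_card:
  fixes x :: "'a::{field, finite}"
  shows "x ^ card (UNIV :: 'a set) = x"
proof (cases "x = 0")
  case True
  then show ?thesis by (simp add: card_gt_0_iff)
next
  case False
  let ?U = "UNIV - {0::'a}"
  have "(\<Prod>y\<in>?U. x * y) = (\<Prod>y\<in>?U. y)"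
    by (rule prod.reindex_bij_witness[of _ "\<lambda>y. y / x" "\<lambda>y. x * y"]) (use False in auto)
  then have "x ^ card ?U = 1"
    by (simp add: prod.distrib)
  moreover have "card (UNIV :: 'a set) = Suc (card ?U)"
    using card_Suc_Diff1[of "UNIV :: 'a set" 0] by simp
  ultimately show ?thesis
    by (simp only: power_Suc mult_1_right)
qed

text \<open>
  The map \<open>\<sigma>\<close> is a parameter so that the results read in terms of \<open>\<sigma>\<close>; the assumption \<open>sig_e\<close> lets
  it replace \<open>sig e\<close> in the formulas for the generators.
\<close>

locale suzuki_field =
  fixes e :: nat and \<sigma> :: "'a::{field, finite} \<Rightarrow> 'a"
  assumes card_field: "card (UNIV :: 'a set) = 2 ^ (2 * e + 1)"
    and e_pos: "0 < e"
    and sig_e: "sig e = \<sigma>"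
begin

lemma sigma_power: "\<sigma> x = x ^ (2 ^ (e + 1))"
  by (simp add: sig_e[symmetric] sig_def)

text \<open>
  Since the field has an even number of elements, raising to that power is the identity and
  sends \<open>- 1\<close> to \<open>1\<close>.
\<close>

lemma one_plus_one [simp]: "(1::'a) + 1 = 0"
proof -
  have "(- 1 :: 'a) ^ (2 ^ (2 * e + 1)) = - 1"
    using finite_field_power_card[of "- 1 :: 'a"] by (simp add: card_field)
  then have "(1::'a) = - 1" by simp
  then show ?thesis by (metis add.right_inverse)
qed

lemma two_eq_zero [simp]: "(2::'a) = 0"
  using one_plus_one by (simp only: one_add_one)

lemma add_self [simp]: "x + x = (0::'a)"
  using two_eq_zero by (metis mult_2 mult_zero_left)

lemma add_self_left [simp]: "x + (x + y) = (y::'a)"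
  by (simp add: add.assoc[symmetric])

lemma minus_char2 [simp]: "- x = (x::'a)"
  using add_self[of x] by (metis add_eq_0_iff)

lemma diff_char2 [simp]: "x - y = x + (y::'a)"
  by (metis diff_conv_add_uminus minus_char2)

lemma add_eq_0_char2 [simp]: "x + y = 0 \<longleftrightarrow> x = (y::'a)"
  by (metis add_eq_0_iff minus_char2)

lemma square_add: "(x + y) ^ 2 = x ^ 2 + (y::'a) ^ 2"
  by (simp add: power2_sum)

lemma power_two_power_add: "(x + y) ^ (2 ^ n) = x ^ (2 ^ n) + (y::'a) ^ (2 ^ n)"
  by (induction n) (simp_all add: power_mult square_add mult.commute[of 2])

lemma sigma_add [simp]: "\<sigma> (x + y) = \<sigma> x + \<sigma> y"
  unfolding sigma_power by (rule power_two_power_add)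

lemma sigma_mult [simp]: "\<sigma> (x * y) = \<sigma> x * \<sigma> y"
  by (simp add: sigma_power power_mult_distrib)

lemma sigma_0 [simp]: "\<sigma> 0 = 0" and sigma_1 [simp]: "\<sigma> 1 = 1"
  by (simp_all add: sigma_power)

lemma sigma_power_nat [simp]: "\<sigma> (x ^ n) = \<sigma> x ^ n"
  by (simp add: sigma_power power_mult[symmetric] mult.commute)

lemma sigma_divide [simp]: "\<sigma> (x / y) = \<sigma> x / \<sigma> y"
  by (simp add: sigma_power power_divide)

lemma sigma_eq_0 [simp]: "\<sigma> x = 0 \<longleftrightarrow> x = 0"
  by (simp add: sigma_power)

lemma sigma_sigma [simp]: "\<sigma> (\<sigma> x) = x ^ 2"
proof -
  have "(2::nat) ^ (e + 1) * 2 ^ (e + 1) = 2 ^ (2 * e + 1) * 2"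
    by (simp flip: power_add power_Suc2)
  then have "\<sigma> (\<sigma> x) = (x ^ (2 ^ (2 * e + 1))) ^ 2"
    by (simp only: sigma_power power_mult[symmetric])
  then show ?thesis
    using finite_field_power_card[of x] by (simp add: card_field)
qed

lemma sigma_fixed: "\<sigma> x = x \<longleftrightarrow> x = 0 \<or> x = 1"
proof
  assume "\<sigma> x = x"
  then have "x ^ 2 = x" using sigma_sigma[of x] by simp
  then show "x = 0 \<or> x = 1" by (simp add: power2_eq_square)
qed auto

lemma square_inj: "x ^ 2 = y ^ 2 \<longleftrightarrow> x = (y::'a)"
  by (metis add_eq_0_char2 square_add power_eq_0_iff)

lemma sigma_inj: "\<sigma> x = \<sigma> y \<longleftrightarrow> x = y"
  by (metis sigma_add sigma_eq_0 add_eq_0_char2)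

lemma sigma_over_id:
  assumes "x \<noteq> 0" and "\<mu> = \<sigma> x / x"
  shows "\<sigma> \<mu> * \<mu> = x"
  using assms by (simp add: power2_eq_square)

text \<open>
  The exponents \<open>\<sigma> + 1\<close> and \<open>\<sigma> - 1\<close> are mutually inverse because \<open>\<sigma>\<^sup>2 = 2\<close>.
\<close>

lemma sigma_plus_one_root:
  obtains \<kappa> where "\<sigma> \<kappa> * \<kappa> = x" and "x \<noteq> 0 \<Longrightarrow> \<kappa> \<noteq> 0"
  by (metis divide_eq_0_iff mult_zero_right sigma_eq_0 sigma_over_id)

text \<open>
  This is where \<open>q > 2\<close> enters: without a third element \<open>\<sigma>\<close> would be squaring, the monomial
  \<open>\<sigma> x * x ^ 2\<close> would be additive, and the flag graph would be disconnected.
\<close>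

lemma third_element: obtains c :: 'a where "c \<noteq> 0" "c \<noteq> 1"
proof -
  have "(2::nat) ^ 1 < 2 ^ (2 * e + 1)"
    using e_pos by (intro power_strict_increasing) auto
  then have "card (UNIV :: 'a set) > 2" by (simp add: card_field)
  moreover have "card {0, 1 :: 'a} \<le> 2" by (simp add: card_insert_if)
  ultimately have "\<not> UNIV \<subseteq> {0, 1 :: 'a}" using card_mono[of "{0, 1 :: 'a}" UNIV] by fastforce
  then show ?thesis using that by blast
qed

lemma sigma_not_square: obtains y where "\<sigma> y \<noteq> y ^ 2"
proof -
  obtain y :: 'a where y: "y \<noteq> 0" "y \<noteq> 1" by (rule third_element)
  have "\<sigma> (\<sigma> y) \<noteq> \<sigma> y ^ 2"
    using y by (metis sigma_sigma square_inj sigma_fixed)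
  then show ?thesis by (rule that)
qed

text \<open>
  Replaces a comparison of coefficients: in the identities below every term except the one with
  \<open>\<sigma> x * x ^ 2\<close> is additive in \<open>x\<close>. Additivity at \<open>x\<close> and \<open>1\<close> already gives \<open>\<sigma> x = x ^ 2\<close>.
\<close>

lemma sigma_plus_two_not_additive:
  assumes add: "\<And>x y. f (x + y) = f x + f y" and f: "\<And>x. f x = c * (\<sigma> x * x ^ 2)"
  shows "c = 0"
proof (rule ccontr)
  assume c: "c \<noteq> 0"
  have "\<sigma> x = x ^ 2" for x
  proof -
    have "c * (\<sigma> (x + 1) * (x + 1) ^ 2) = c * (\<sigma> x * x ^ 2 + 1)"
      using add[of x 1] unfolding f by (simp add: algebra_simps)
    then have "\<sigma> (x + 1) * (x + 1) ^ 2 = \<sigma> x * x ^ 2 + 1" using c by simp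
    then have "\<sigma> x + x ^ 2 = 0" by (simp add: square_add algebra_simps)
    then show ?thesis by simp
  qed
  then show False by (metis sigma_not_square)
qed

section \<open>The ovoid and the generators\<close>

text \<open>
  The third coordinate of a point of the ovoid as a function of the first two. It vanishes only
  at the origin (\<open>nrm_eq_0\<close>), so that \<open>w\<close> interchanges \<open>\<infinity>\<close> with a single affine point.
\<close>

definition nrm :: "'a \<Rightarrow> 'a \<Rightarrow> 'a" where
  "nrm x y = x * y + \<sigma> x * x ^ 2 + \<sigma> y"

definition pt :: "'a \<Rightarrow> 'a \<Rightarrow> 'a sz_point" where
  "pt x y = Aff x y (nrm x y)"

abbreviation V :: "'a sz_point set" where "V \<equiv> sz_points e"

abbreviation T :: "'a \<Rightarrow> 'a \<Rightarrow> 'a sz_point \<Rightarrow> 'a sz_point" where "T \<equiv> sz_t e"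
abbreviation M :: "'a \<Rightarrow> 'a sz_point \<Rightarrow> 'a sz_point" where "M \<equiv> sz_n e"
abbreviation W :: "'a sz_point \<Rightarrow> 'a sz_point" where "W \<equiv> sz_w e"

lemma pt_eq [simp]: "pt x y = pt x' y' \<longleftrightarrow> x = x' \<and> y = y'"
  by (auto simp: pt_def)

lemma pt_not_Infty [simp]: "pt x y \<noteq> Infty" "Infty \<noteq> pt x y"
  by (simp_all add: pt_def)

lemma pt_0: "Aff 0 0 0 = pt 0 0"
  by (simp add: pt_def nrm_def)

lemma V_eq: "V = insert Infty (range (\<lambda>(x, y). pt x y))"
  by (auto simp: sz_points_def pt_def nrm_def sig_e)

lemma Infty_in [simp]: "Infty \<in> V" and pt_in [simp]: "pt x y \<in> V"
  by (auto simp: V_eq)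

lemma V_cases [consumes 1, case_names Infty pt]:
  assumes "p \<in> V" obtains "p = Infty" | x y where "p = pt x y"
  using assms by (auto simp: V_eq)

lemma finite_V [simp]: "finite V"
  by (simp add: V_eq)

lemma card_V: "card V = card (UNIV :: 'a set) ^ 2 + 1"
proof -
  have "inj (\<lambda>(x, y). pt x y)" by (auto intro: injI)
  then have "card (range (\<lambda>(x, y). pt x y)) = card (UNIV :: ('a \<times> 'a) set)"
    by (rule card_image)
  moreover have "Infty \<notin> range (\<lambda>(x, y). pt x y)" by auto
  ultimately show ?thesis
    by (simp add: V_eq UNIV_Times_UNIV[symmetric] card_cartesian_product power2_eq_square
        del: UNIV_Times_UNIV)
qed

text \<open>
  For \<open>x \<noteq> 0\<close> the quotient \<open>z = y / (\<sigma> x * x)\<close> would satisfy \<open>\<sigma> z = z + 1\<close>; applying \<open>\<sigma>\<close> once more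
  gives \<open>z ^ 2 = z\<close>, and both solutions contradict the first equation.
\<close>

lemma nrm_eq_0: "nrm x y = 0 \<longleftrightarrow> x = 0 \<and> y = 0"
proof
  assume n: "nrm x y = 0"
  show "x = 0 \<and> y = 0"
  proof (cases "x = 0")
    case True
    then show ?thesis using n by (simp add: nrm_def)
  next
    case False
    define z where "z = y / (\<sigma> x * x)"
    have y: "y = z * (\<sigma> x * x)" using False by (simp add: z_def)
    have "nrm x y = (\<sigma> x * x ^ 2) * (z + 1 + \<sigma> z)"
      by (simp add: y nrm_def algebra_simps power2_eq_square)
    then have z: "\<sigma> z = z + 1" using n False by (simp add: add.commute)
    from z have "z ^ 2 = z" using sigma_sigma[of z] by (simp add: add.assoc)
    then have "z = 0 \<or> z = 1" by (simp add: power2_eq_square)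
    then show ?thesis using z by auto
  qed
qed (simp add: nrm_def)

lemma T_Infty [simp]: "T a b Infty = Infty"
  by (simp add: sz_t_def)

lemma T_pt [simp]: "T a b (pt x y) = pt (x + a) (y + b + \<sigma> a * x)"
proof -
  have "T a b (pt x y) = Aff (x + a) (y + b + \<sigma> a * x)
      (nrm x y + a * b + \<sigma> a * a ^ 2 + \<sigma> b + a * y + \<sigma> a * a * x + b * x)"
    using pt_in[of x y] by (simp add: sz_t_def pt_def sig_e)
  also have "\<dots> = pt (x + a) (y + b + \<sigma> a * x)"
    by (simp add: pt_def nrm_def algebra_simps power2_eq_square)
  finally show ?thesis .
qed

lemma T_cancel:
  assumes "p \<in> V" shows "T a b (T a (b + \<sigma> a * a) p) = p"
  using assms by (cases rule: V_cases) (simp_all add: algebra_simps)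

lemma T_0_cancel: "p \<in> V \<Longrightarrow> T 0 b (T 0 b p) = p"
  using T_cancel[of p 0 b] by simp

lemma M_Infty [simp]: "M k Infty = Infty"
  by (simp add: sz_n_def)

lemma M_pt [simp]: "M k (pt x y) = pt (k * x) (\<sigma> k * k * y)"
proof -
  have "M k (pt x y) = Aff (k * x) (\<sigma> k * k * y) (\<sigma> k * k ^ 2 * nrm x y)"
    using pt_in[of x y] by (simp add: sz_n_def pt_def sig_e)
  also have "\<dots> = pt (k * x) (\<sigma> k * k * y)"
    by (simp add: pt_def nrm_def algebra_simps power2_eq_square)
  finally show ?thesis .
qed

lemma W_Infty [simp]: "W Infty = pt 0 0"
  by (simp add: sz_w_def pt_0)

lemma W_0 [simp]: "W (pt 0 0) = Infty"
  using pt_in[of 0 0] by (simp add: sz_w_def pt_0[symmetric])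

text \<open>
  The reason why \<open>w\<close> maps the ovoid to itself.
\<close>

lemma nrm_inverse:
  assumes "n \<noteq> 0" and n: "n = nrm x y"
  shows "nrm (y / n) (x / n) = 1 / n"
proof -
  have "n ^ 2 * \<sigma> n * nrm (y / n) (x / n) = x * y * \<sigma> n + \<sigma> y * y ^ 2 + \<sigma> x * n ^ 2"
    using \<open>n \<noteq> 0\<close> by (simp add: nrm_def field_simps power2_eq_square)
  also have "\<dots> = n * \<sigma> n"
    by (simp add: n nrm_def algebra_simps power2_eq_square)
  finally have "n * (n * \<sigma> n) * nrm (y / n) (x / n) = n * \<sigma> n"
    by (simp add: power2_eq_square mult.assoc)
  then show ?thesis
    using \<open>n \<noteq> 0\<close> by (simp add: field_simps)
qed

lemma W_pt:
  assumes "x \<noteq> 0 \<or> y \<noteq> 0"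
  shows "W (pt x y) = pt (y / nrm x y) (x / nrm x y)"
proof -
  have "nrm x y \<noteq> 0" using assms by (simp add: nrm_eq_0)
  then show ?thesis
    using pt_in[of x y] nrm_inverse[of "nrm x y" x y] by (simp add: sz_w_def pt_def)
qed

lemma W_W [simp]: assumes "p \<in> V" shows "W (W p) = p"
  using assms
proof (cases p rule: V_cases)
  case (pt x y)
  show ?thesis
  proof (cases "x = 0 \<and> y = 0")
    case False
    then have n: "nrm x y \<noteq> 0" by (simp add: nrm_eq_0)
    then have "y / nrm x y \<noteq> 0 \<or> x / nrm x y \<noteq> 0" using False by auto
    then show ?thesis
      using False n nrm_inverse[OF n] by (simp add: pt W_pt)
  qed (simp add: pt)
qed simp

end

section \<open>Groups of permutations of a set\<close>

locale permutation_subgroup =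
  fixes S :: "'v set" and H :: "('v \<Rightarrow> 'v) set"
  assumes subgroup_H: "subgroup H (BijGroup S)"
begin

lemma in_Bij: "g \<in> H \<Longrightarrow> g \<in> Bij S"
  using subgroup.subset[OF subgroup_H] by (auto simp: BijGroup_def)

lemma maps: "g \<in> H \<Longrightarrow> x \<in> S \<Longrightarrow> g x \<in> S"
  by (blast dest: in_Bij Bij_imp_funcset)

lemma inj: "g \<in> H \<Longrightarrow> inj_on g S"
  by (auto dest: in_Bij simp: Bij_def bij_betw_def)

lemma eq_iff [simp]: "g \<in> H \<Longrightarrow> x \<in> S \<Longrightarrow> y \<in> S \<Longrightarrow> g x = g y \<longleftrightarrow> x = y"
  using inj by (auto dest: inj_onD)

lemma compose_in: "g \<in> H \<Longrightarrow> h \<in> H \<Longrightarrow> compose S g h \<in> H"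
  using subgroup.m_closed[OF subgroup_H, of g h] in_Bij by (simp add: BijGroup_def)

lemma id_in: "(\<lambda>x\<in>S. x) \<in> H"
  using subgroup.one_closed[OF subgroup_H] by (simp add: BijGroup_def)

lemma inverse:
  assumes "g \<in> H"
  obtains h where "h \<in> H" "\<And>x. x \<in> S \<Longrightarrow> h (g x) = x" "\<And>x. x \<in> S \<Longrightarrow> g (h x) = x"
proof -
  let ?h = "inv\<^bsub>BijGroup S\<^esub> g"
  interpret group "BijGroup S" by (rule group_BijGroup)
  have g: "g \<in> carrier (BijGroup S)" and h: "?h \<in> H"
    using assms subgroup.mem_carrier[OF subgroup_H] subgroup.m_inv_closed[OF subgroup_H] by auto
  then have gB: "g \<in> Bij S" and hB: "?h \<in> Bij S" using in_Bij assms by auto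
  have "compose S ?h g = (\<lambda>x\<in>S. x)" and "compose S g ?h = (\<lambda>x\<in>S. x)"
    using l_inv[OF g] r_inv[OF g] gB hB by (simp_all add: BijGroup_def)
  then have "?h (g x) = x" "g (?h x) = x" if "x \<in> S" for x
    using that by (metis compose_eq restrict_apply')+
  then show ?thesis using that h by blast
qed

lemma image_compose: "A \<subseteq> S \<Longrightarrow> compose S g h ` A = g ` h ` A"
  by (force simp: compose_def)

lemma image_id: "A \<subseteq> S \<Longrightarrow> (\<lambda>x\<in>S. x) ` A = A"
  by force

lemma image_inverse: "A \<subseteq> S \<Longrightarrow> (\<And>x. x \<in> S \<Longrightarrow> h (g x) = x) \<Longrightarrow> h ` g ` A = A"
  by (force simp: image_image)

lemma image_subset: "g \<in> H \<Longrightarrow> A \<subseteq> S \<Longrightarrow> g ` A \<subseteq> S"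
  using maps by blast

end

lemma (in permutation_subgroup) subgroup_point_set_stabilizer:
  assumes "x \<in> S" "A \<subseteq> S"
  shows "subgroup (point_set_stabilizer (perm_group S H) x A) (BijGroup S)" (is "subgroup ?K _")
proof (rule group.subgroupI[OF group_BijGroup])
  have K_iff: "g \<in> ?K \<longleftrightarrow> g \<in> H \<and> g x = x \<and> g ` A = A" for g
    by (auto simp: point_set_stabilizer_def point_stabilizer_def stabilizer_def)
  show "?K \<subseteq> carrier (BijGroup S)"
    using subgroup.subset[OF subgroup_H] by (auto simp: K_iff)
  show "?K \<noteq> {}"
    using assms id_in K_iff image_id by (metis empty_iff restrict_apply')
  fix g assume g: "g \<in> ?K"
  then have gB: "g \<in> Bij S" using in_Bij K_iff by blast
  have inv_g: "(inv\<^bsub>BijGroup S\<^esub> g) (g y) = y" if "y \<in> S" for y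
    using that gB Bij_imp_funcset[OF gB]
    by (auto simp: inv_BijGroup Bij_def bij_betw_def)
  have "(inv\<^bsub>BijGroup S\<^esub> g) x = x"
    using inv_g[OF assms(1)] g by (simp add: K_iff)
  moreover have "(inv\<^bsub>BijGroup S\<^esub> g) ` A = A"
    using image_inverse[where g = g, OF assms(2)] inv_g g by (metis K_iff)
  ultimately show "inv\<^bsub>BijGroup S\<^esub> g \<in> ?K"
    using g subgroup.m_inv_closed[OF subgroup_H] by (simp add: K_iff)
  fix h assume h: "h \<in> ?K"
  then have "h \<in> Bij S" using in_Bij K_iff by blast
  then have "g \<otimes>\<^bsub>BijGroup S\<^esub> h = compose S g h" using gB by (simp add: BijGroup_def)
  then show "g \<otimes>\<^bsub>BijGroup S\<^esub> h \<in> ?K"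
    using g h assms compose_in by (simp add: K_iff image_compose compose_eq)
qed

section \<open>The Suzuki group and its 2-transitivity\<close>

context suzuki_field
begin

lemma T_in_Bij: "T a b \<in> Bij V"
proof -
  have "bij_betw (T a b) V V"
    by (rule bij_betw_byWitness[where f' = "T a (b + \<sigma> a * a)"])
      (auto elim!: V_cases simp: algebra_simps)
  then show ?thesis by (simp add: Bij_def sz_t_def)
qed

lemma M_in_Bij:
  assumes "k \<noteq> 0" shows "M k \<in> Bij V"
proof -
  have "bij_betw (M k) V V"
    using assms by (intro bij_betw_byWitness[where f' = "M (1 / k)"]) (auto elim!: V_cases)
  then show ?thesis by (simp add: Bij_def sz_n_def)
qed

lemma W_in: "p \<in> V \<Longrightarrow> W p \<in> V"
  by (metis V_cases W_0 W_Infty W_pt Infty_in pt_in)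

lemma W_in_Bij: "W \<in> Bij V"
proof -
  have "bij_betw W V V"
    by (rule bij_betw_byWitness[where f' = W]) (auto simp: W_in)
  then show ?thesis by (simp add: Bij_def sz_w_def)
qed

abbreviation Sz :: "('a sz_point \<Rightarrow> 'a sz_point) set" where "Sz \<equiv> suzuki e"

lemma generators_in_Bij:
  "{W} \<union> {T a b | a b. True} \<union> {M k | k. k \<noteq> 0} \<subseteq> carrier (BijGroup V)"
  using T_in_Bij M_in_Bij W_in_Bij by (auto simp: BijGroup_def)

sublocale sz: permutation_subgroup V Sz
proof (rule permutation_subgroup.intro)
  show "subgroup Sz (BijGroup V)"
    unfolding suzuki_def
    by (rule group.generate_is_subgroup[OF group_BijGroup generators_in_Bij])
qed

lemma T_in_Sz: "T a b \<in> Sz" and M_in_Sz: "k \<noteq> 0 \<Longrightarrow> M k \<in> Sz" and W_in_Sz: "W \<in> Sz"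
  unfolding suzuki_def by (auto intro: generate.incl)

lemma Sz_from_base:
  assumes "x \<in> V" "y \<in> V" "x \<noteq> y"
  obtains g where "g \<in> Sz" "g Infty = x" "g (pt 0 0) = y"
proof -
  have "\<exists>g\<in>Sz. g x = Infty"
    using \<open>x \<in> V\<close>
  proof (cases x rule: V_cases)
    case Infty
    then show ?thesis by (intro bexI[OF _ sz.id_in]) simp
  next
    case (pt a b)
    show ?thesis
      by (rule bexI[OF _ sz.compose_in[OF W_in_Sz T_in_Sz[of a "b + \<sigma> a * a"]]])
        (simp add: pt compose_eq add_ac)
  qed
  then obtain g where g: "g \<in> Sz" "g x = Infty" by blast
  then have "g y \<noteq> Infty" using assms sz.eq_iff by metis
  then obtain a b where "g y = pt a b"
    using sz.maps[OF g(1) \<open>y \<in> V\<close>] by (auto elim: V_cases)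
  then have "T a (b + \<sigma> a * a) (g y) = pt 0 0" "T a (b + \<sigma> a * a) (g x) = Infty"
    by (simp_all add: g add_ac)
  then obtain h where h: "h \<in> Sz" "h x = Infty" "h y = pt 0 0"
    using assms sz.compose_in[OF T_in_Sz g(1)] by (metis compose_eq)
  show ?thesis
    by (rule sz.inverse[OF h(1)]) (metis that h(2,3) assms(1,2))
qed

lemma two_transitive_Sz: "two_transitive_on Sz V"
  unfolding two_transitive_on_def
proof (intro ballI impI)
  fix x y x' y' assume V: "x \<in> V" "y \<in> V" "x' \<in> V" "y' \<in> V" and ne: "x \<noteq> y" "x' \<noteq> y'"
  obtain g where g: "g \<in> Sz" "g Infty = x" "g (pt 0 0) = y" using V ne by (metis Sz_from_base)
  obtain h where h: "h \<in> Sz" "h Infty = x'" "h (pt 0 0) = y'" using V ne by (metis Sz_from_base)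
  obtain i where i: "i \<in> Sz" "\<And>z. z \<in> V \<Longrightarrow> i (g z) = z"
    using sz.inverse[OF g(1)] by metis
  show "\<exists>g\<in>Sz. g x = x' \<and> g y = y'"
    by (rule bexI[OF _ sz.compose_in[OF h(1) i(1)]]) (use V g h i in \<open>force simp: compose_eq\<close>)
qed

end

section \<open>The invariant alternating form and two-point stabilizers\<close>

text \<open>
  The alternating form \<open>x\<^sub>0 y\<^sub>3 + x\<^sub>3 y\<^sub>0 + x\<^sub>1 y\<^sub>2 + x\<^sub>2 y\<^sub>1\<close> evaluated at the vectors \<open>(1, x\<^sub>1, x\<^sub>2, x\<^sub>3)\<close>
  and \<open>(0, 0, 0, 1)\<close> that represent the affine points and \<open>\<infinity>\<close>.
\<close>

fun form :: "'a::field sz_point \<Rightarrow> 'a sz_point \<Rightarrow> 'a" where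
  "form Infty Infty = 0"
| "form Infty (Aff y1 y2 y3) = 1"
| "form (Aff x1 x2 x3) Infty = 1"
| "form (Aff x1 x2 x3) (Aff y1 y2 y3) = x3 + y3 + x1 * y2 + x2 * y1"

context suzuki_field
begin

text \<open>
  The factor \<open>l p\<close> accounts for the choice of the vector representing \<open>p\<close>. Stated on points,
  the property needs neither matrices nor vectors and is visibly closed under products.
\<close>

definition form_similarity :: "('a sz_point \<Rightarrow> 'a sz_point) \<Rightarrow> bool" where
  "form_similarity g \<longleftrightarrow> (\<exists>c l. c \<noteq> 0 \<and> (\<forall>p\<in>V. l p \<noteq> 0) \<and>
     (\<forall>p\<in>V. \<forall>r\<in>V. form (g p) (g r) = c * l p * l r * form p r))"

lemma form_Infty_pt [simp]: "form Infty (pt x y) = 1" "form (pt x y) Infty = 1"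
  by (simp_all add: pt_def)

lemma form_pt [simp]:
  "form (pt x y) (pt x' y') = nrm x y + nrm x' y' + x * y' + y * x'"
  by (simp add: pt_def)

lemma nrm_0 [simp]: "nrm 0 0 = 0"
  by (simp add: nrm_eq_0)

lemma form_similarity_T: "form_similarity (T a b)"
  unfolding form_similarity_def
proof (intro exI[of _ 1] exI[of _ "\<lambda>_. 1"] conjI ballI)
  fix p r assume "p \<in> V" "r \<in> V"
  then show "form (T a b p) (T a b r) = 1 * 1 * 1 * form p r"
    by (elim V_cases) (auto simp: nrm_def algebra_simps power2_eq_square)
qed auto

lemma nrm_scale: "nrm (k * x) (\<sigma> k * k * y) = \<sigma> k * k ^ 2 * nrm x y"
  by (simp add: nrm_def algebra_simps power2_eq_square)

lemma form_similarity_M: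
  assumes "k \<noteq> 0" shows "form_similarity (M k)"
  unfolding form_similarity_def
proof (intro exI[of _ "\<sigma> k * k ^ 2"] exI[of _ "\<lambda>p. if p = Infty then 1 / (\<sigma> k * k ^ 2) else 1"]
    conjI ballI)
  \<comment> \<open>the diagonal matrix of \<open>M k\<close> maps the vector of \<open>\<infinity>\<close> to \<open>\<sigma> k * k ^ 2\<close> times itself\<close>
  fix p r assume "p \<in> V" "r \<in> V"
  then show "form (M k p) (M k r) = \<sigma> k * k ^ 2 * (if p = Infty then 1 / (\<sigma> k * k ^ 2) else 1) *
      (if r = Infty then 1 / (\<sigma> k * k ^ 2) else 1) * form p r"
    using assms
    by (elim V_cases) (auto simp: nrm_scale, simp add: algebra_simps power2_eq_square)
qed (use assms in auto)

lemma W_pt': "W (pt x y) =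
    (if nrm x y = 0 then Infty else Aff (y / nrm x y) (x / nrm x y) (1 / nrm x y))"
proof (cases "nrm x y = 0")
  case True
  then show ?thesis using nrm_eq_0[of x y] by simp
next
  case False
  then have "W (pt x y) = pt (y / nrm x y) (x / nrm x y)"
    using W_pt[of x y] by (auto simp: nrm_eq_0)
  then show ?thesis using False nrm_inverse[OF False] by (simp add: pt_def)
qed

lemma form_similarity_W: "form_similarity W"
  unfolding form_similarity_def
proof (intro exI[of _ 1]
    exI[of _ "\<lambda>p. case p of Infty \<Rightarrow> 1 | Aff x1 x2 x3 \<Rightarrow> if x3 = 0 then 1 else 1 / x3"] conjI ballI)
  \<comment> \<open>\<open>w\<close> reverses the coordinate vector, which leaves the form unchanged; normalizing the result
      divides by \<open>x\<^sub>3\<close>, except at the origin, which becomes the vector of \<open>\<infinity>\<close>.\<close>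
  let ?l = "\<lambda>p. case p of Infty \<Rightarrow> 1 | Aff x1 x2 x3 \<Rightarrow> if x3 = 0 then 1 else 1 / x3"
  have inverse: "1 / m + 1 / n + y / m * (x' / n) + x / m * (y' / n)
      = 1 / m * (1 / n) * (m + n + x * y' + y * x')" if "m \<noteq> 0" "n \<noteq> 0" for m n x y x' y' :: 'a
    using that by (simp add: divide_simps)
  have axes: "x = 0 \<and> y = 0" if "nrm x y = 0" for x y using that by (simp add: nrm_eq_0)
  fix p r assume "p \<in> V" "r \<in> V"
  then show "form (W p) (W r) = 1 * ?l p * ?l r * form p r"
  proof (elim V_cases)
    fix x y x' y' assume p: "p = pt x y" and r: "r = pt x' y'"
    consider "nrm x y = 0" | "nrm x' y' = 0" | "nrm x y \<noteq> 0" "nrm x' y' \<noteq> 0" by blast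
    then show ?thesis
    proof cases
      case 1
      then show ?thesis
        using axes[OF 1] by (simp add: p r W_pt') (simp add: pt_def)
    next
      case 2
      then show ?thesis
        using axes[OF 2] by (simp add: p r W_pt') (simp add: pt_def)
    next
      case 3
      then have l: "?l (pt x y) = 1 / nrm x y" "?l (pt x' y') = 1 / nrm x' y'"
        by (simp_all add: pt_def)
      then show ?thesis
        using inverse[OF 3, of y x' x y']
        by (simp only: p r W_pt' 3 if_False form.simps form_pt l mult_1_left)
    qed
  next
    fix x y assume p: "p = pt x y" and r: "r = Infty"
    show ?thesis using pt_0 axes[of x y] by (simp add: p r W_pt') (simp add: pt_def)
  next
    fix x y assume p: "p = Infty" and r: "r = pt x y"
    show ?thesis using pt_0 axes[of x y] by (simp add: p r W_pt') (simp add: pt_def)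
  qed simp
qed (auto split: sz_point.split)

lemma form_similarity_Sz: 
  assumes "g \<in> Sz" shows "form_similarity g"
proof -
  let ?K = "{g \<in> Bij V. form_similarity g}"
  have "subgroup ?K (BijGroup V)"
  proof (rule group.subgroupI[OF group_BijGroup])
    show "?K \<subseteq> carrier (BijGroup V)" by (auto simp: BijGroup_def)
    show "?K \<noteq> {}" using W_in_Bij form_similarity_W by blast
  next
    fix g assume g: "g \<in> ?K"
    let ?h = "inv\<^bsub>BijGroup V\<^esub> g"
    have hB: "?h \<in> Bij V"
      using g by (simp add: inv_BijGroup restrict_inv_into_Bij)
    have gh: "g (?h p) = p" if "p \<in> V" for p
      using g that by (auto simp: inv_BijGroup Bij_def dest: bij_betw_inv_into_right)
    obtain c l where cl: "c \<noteq> 0" "\<And>p. p \<in> V \<Longrightarrow> l p \<noteq> 0"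
      "\<And>p r. p \<in> V \<Longrightarrow> r \<in> V \<Longrightarrow> form (g p) (g r) = c * l p * l r * form p r"
      using g unfolding form_similarity_def by blast
    have hV: "?h p \<in> V" if "p \<in> V" for p using hB that Bij_imp_funcset by blast
    have "form (?h p) (?h r) = 1 / c * (1 / l (?h p)) * (1 / l (?h r)) * form p r"
      if "p \<in> V" "r \<in> V" for p r
      using cl(3)[of "?h p" "?h r"] cl(1) cl(2) hV gh that by (simp add: field_simps)
    then have "form_similarity ?h"
      unfolding form_similarity_def using cl(1,2) hV
      by (intro exI[of _ "1 / c"] exI[of _ "\<lambda>p. 1 / l (?h p)"]) auto
    then show "?h \<in> ?K" using hB by blast
  next
    fix g h assume g: "g \<in> ?K" and h: "h \<in> ?K"
    obtain c l where cl: "c \<noteq> 0" "\<And>p. p \<in> V \<Longrightarrow> l p \<noteq> 0"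
      "\<And>p r. p \<in> V \<Longrightarrow> r \<in> V \<Longrightarrow> form (g p) (g r) = c * l p * l r * form p r"
      using g unfolding form_similarity_def by blast
    obtain d m where dm: "d \<noteq> 0" "\<And>p. p \<in> V \<Longrightarrow> m p \<noteq> 0"
      "\<And>p r. p \<in> V \<Longrightarrow> r \<in> V \<Longrightarrow> form (h p) (h r) = d * m p * m r * form p r"
      using h unfolding form_similarity_def by blast
    have hV: "h p \<in> V" if "p \<in> V" for p using h that Bij_imp_funcset by blast
    have "form_similarity (compose V g h)"
      unfolding form_similarity_def
      by (intro exI[of _ "c * d"] exI[of _ "\<lambda>p. m p * l (h p)"])
        (use cl dm hV in \<open>auto simp: compose_eq\<close>)
    then show "g \<otimes>\<^bsub>BijGroup V\<^esub> h \<in> ?K"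
      using g h by (simp add: BijGroup_def compose_Bij)
  qed
  then have "Sz \<subseteq> ?K"
    unfolding suzuki_def
    by (intro group.generate_subgroup_incl[OF group_BijGroup])
      (use T_in_Bij M_in_Bij W_in_Bij form_similarity_T form_similarity_M form_similarity_W in auto)
  then show ?thesis using assms by blast
qed

text \<open>
  The values of the form on pairs with \<open>\<infinity>\<close> show that all affine points have the same factor,
  so that the map \<open>(x, y) \<mapsto> (u, v)\<close> induced on the first two coordinates multiplies the determinant
  by a constant \<open>d\<close>; hence it is linear. The values on pairs with the origin show that the third
  coordinate is multiplied by \<open>d\<close>, and restricting the ovoid equation to the two axes leaves only
  the scalings.
\<close>

lemma two_point_stabilizer:
  assumes g: "g \<in> Sz" and fix_Infty: "g Infty = Infty" and fix_0: "g (pt 0 0) = pt 0 0"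
  obtains k where "k \<noteq> 0" "g = M k"
proof -
  obtain c l where c: "c \<noteq> 0" and l: "\<And>p. p \<in> V \<Longrightarrow> l p \<noteq> 0"
    and cl: "\<And>p r. p \<in> V \<Longrightarrow> r \<in> V \<Longrightarrow> form (g p) (g r) = c * l p * l r * form p r"
    using form_similarity_Sz[OF g] unfolding form_similarity_def by blast
  have "\<exists>u v. g (pt x y) = pt u v" for x y
    using sz.maps[OF g, of "pt x y"] sz.eq_iff[OF g, of "pt x y" Infty] fix_Infty
    by (metis V_cases Infty_in pt_in pt_not_Infty(1))
  then obtain u v where uv: "\<And>x y. g (pt x y) = pt (u x y) (v x y)" by metis
  define l0 where "l0 = 1 / (c * l Infty)"
  have l0: "l (pt x y) = l0" for x y
    using cl[of Infty "pt x y"] l[of Infty] c by (simp add: fix_Infty uv l0_def field_simps)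
  define d where "d = c * l0 * l0"
  have d: "d \<noteq> 0" using c l[of Infty] by (simp add: d_def l0_def)
  have fd: "form (g (pt x y)) (g (pt x' y')) = d * form (pt x y) (pt x' y')" for x y x' y'
    using cl[of "pt x y" "pt x' y'"] by (simp add: l0 d_def)
  have uv_0: "u 0 0 = 0" "v 0 0 = 0"
    using uv[of 0 0] fix_0 by simp_all
  have n: "nrm (u x y) (v x y) = d * nrm x y" for x y
    using fd[of x y 0 0] uv_0 by (simp add: uv)
  have det: "u x y * v x' y' + v x y * u x' y' = d * (x * y' + y * x')" for x y x' y'
    using fd[of x y x' y'] by (simp add: uv n algebra_simps)
  define u1 v1 u2 v2 where "u1 = u 1 0" and "v1 = v 1 0" and "u2 = u 0 1" and "v2 = v 0 1"
  have d_eq: "u1 * v2 + v1 * u2 = d"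
    using det[of 1 0 0 1] by (simp add: u1_def v1_def u2_def v2_def)
  have r1: "u x y * v1 + v x y * u1 = d * y" and r2: "u x y * v2 + v x y * u2 = d * x" for x y
    using det[of x y 1 0] det[of x y 0 1] by (simp_all add: u1_def v1_def u2_def v2_def)
  \<comment> \<open>Cramer's rule for the system \<open>r1\<close>, \<open>r2\<close>, whose determinant is \<open>d\<close>\<close>
  have "d * u x y = u1 * (u x y * v2 + v x y * u2) + u2 * (u x y * v1 + v x y * u1)" for x y
    by (simp add: d_eq[symmetric] algebra_simps)
  then have "d * u x y = u1 * (d * x) + u2 * (d * y)" for x y
    by (simp only: r1 r2)
  then have "d * u x y = d * (x * u1 + y * u2)" for x y
    by (simp add: algebra_simps)
  then have u: "u x y = x * u1 + y * u2" for x y using d by simp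
  have "d * v x y = v1 * (u x y * v2 + v x y * u2) + v2 * (u x y * v1 + v x y * u1)" for x y
    by (simp add: d_eq[symmetric] algebra_simps)
  then have "d * v x y = v1 * (d * x) + v2 * (d * y)" for x y
    by (simp only: r1 r2)
  then have "d * v x y = d * (x * v1 + y * v2)" for x y
    by (simp add: algebra_simps)
  then have v: "v x y = x * v1 + y * v2" for x y using d by simp
  have y_axis: "\<sigma> u2 * u2 ^ 2 * (\<sigma> y * y ^ 2) = u2 * v2 * y ^ 2 + (\<sigma> v2 + d) * \<sigma> y" for y
  proof -
    have "nrm (y * u2) (y * v2) = d * \<sigma> y" using n[of 0 y] by (simp add: u v nrm_def)
    then have "nrm (y * u2) (y * v2) + (u2 * v2 * y ^ 2 + \<sigma> v2 * \<sigma> y)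
        = d * \<sigma> y + (u2 * v2 * y ^ 2 + \<sigma> v2 * \<sigma> y)" by simp
    then show ?thesis by (simp add: nrm_def power2_eq_square algebra_simps)
  qed
  have "\<sigma> u2 * u2 ^ 2 = 0"
    by (rule sigma_plus_two_not_additive[of "\<lambda>y. u2 * v2 * y ^ 2 + (\<sigma> v2 + d) * \<sigma> y"])
      (simp add: square_add algebra_simps, rule y_axis[symmetric])
  then have u2: "u2 = 0" by simp
  have dv2: "d = \<sigma> v2" using y_axis[of 1] u2 by simp
  have x_axis: "(\<sigma> u1 * u1 ^ 2 + d) * (\<sigma> x * x ^ 2) = u1 * v1 * x ^ 2 + \<sigma> v1 * \<sigma> x" for x
  proof -
    have "nrm (x * u1) (x * v1) = d * (\<sigma> x * x ^ 2)" using n[of x 0] by (simp add: u v nrm_def)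
    then have "nrm (x * u1) (x * v1) + (d * (\<sigma> x * x ^ 2) + (u1 * v1 * x ^ 2 + \<sigma> v1 * \<sigma> x))
        = u1 * v1 * x ^ 2 + \<sigma> v1 * \<sigma> x" by (simp add: add_ac)
    then show ?thesis by (simp add: nrm_def power2_eq_square algebra_simps)
  qed
  have "\<sigma> u1 * u1 ^ 2 + d = 0"
    by (rule sigma_plus_two_not_additive[of "\<lambda>x. u1 * v1 * x ^ 2 + \<sigma> v1 * \<sigma> x"])
      (simp add: square_add algebra_simps, rule x_axis[symmetric])
  then have du1: "d = \<sigma> u1 * u1 ^ 2" by simp
  have v1: "v1 = 0"
  proof (rule ccontr)
    assume "v1 \<noteq> 0"
    have eq: "u1 * v1 * x ^ 2 = \<sigma> v1 * \<sigma> x" for x using x_axis[of x] du1 by simp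
    have "\<sigma> x = x ^ 2" for x using eq[of 1] eq[of x] \<open>v1 \<noteq> 0\<close> by simp
    then show False by (metis sigma_not_square)
  qed
  have "\<sigma> v2 = \<sigma> (\<sigma> u1 * u1)" using dv2 du1 by (simp add: mult.commute)
  then have v2: "v2 = \<sigma> u1 * u1" by (simp only: sigma_inj)
  have u1: "u1 \<noteq> 0" using du1 d by auto
  have "g p = M u1 p" if "p \<in> V" for p
    using that by (cases p rule: V_cases) (simp_all add: fix_Infty uv u v u2 v1 v2 mult_ac)
  then have "g = M u1"
    using sz.in_Bij[OF g] M_in_Bij[OF u1] by (intro extensionalityI[of g V]) (auto simp: Bij_def)
  then show ?thesis using u1 that by blast
qed

end

lemma card_off_diagonal:
  assumes "finite A"
  shows "card {(x, y). x \<in> A \<and> y \<in> A \<and> x \<noteq> y} = card A * (card A - 1)"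
proof -
  have "{(x, y). x \<in> A \<and> y \<in> A \<and> x \<noteq> y} = (SIGMA x:A. A - {x})" by auto
  then show ?thesis using assms by simp
qed

lemma flag_act_pair [simp]: "flag_act g (x, A) = (g x, g ` A)"
  by (simp add: flag_act_def)

section \<open>The flags in the orbit of \<open>(\<infinity>, L)\<close>\<close>

context suzuki_field
begin

definition q :: nat where "q = 2 ^ (2 * e + 1)"

lemma q_ge_2: "q \<ge> 2"
  by (simp add: q_def)

lemma card_UNIV: "card (UNIV :: 'a set) = q"
  by (simp only: card_field q_def)

lemma card_points: "card V = q ^ 2 + 1"
  by (simp only: card_V card_UNIV)

text \<open>
  The blocks of the flags in \<open>\<Omega>\<close> at \<open>\<infinity>\<close> (see \<open>flags_at_Infty\<close>); any two of them meet in \<open>\<infinity>\<close> only.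
\<close>

definition line :: "'a \<Rightarrow> 'a sz_point set" where
  "line a = insert Infty (range (pt a))"

abbreviation L :: "'a sz_point set" where "L \<equiv> line 0"

definition \<Omega> :: "'a sz_point flag set" where
  "\<Omega> = {flag_act g (Infty, L) | g. g \<in> Sz}"

lemma Infty_in_line [simp]: "Infty \<in> line a" and pt_in_line [simp]: "pt x y \<in> line a \<longleftrightarrow> x = a"
  by (auto simp: line_def)

lemma line_inj [simp]: "line a = line b \<longleftrightarrow> a = b"
  by (metis pt_in_line)

lemma line_subset [simp]: "line a \<subseteq> V"
  by (auto simp: line_def)

lemma line_in_V: "p \<in> line a \<Longrightarrow> p \<in> V"
  using line_subset by blast

lemma card_line: "card (line a) = q + 1"
proof -
  have "card (range (pt a)) = q"
    unfolding card_UNIV[symmetric] by (intro card_image injI) simp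
  moreover have "Infty \<notin> range (pt a)" by auto
  ultimately show ?thesis by (simp add: line_def)
qed

lemma T_line [simp]: "T a b ` line c = line (a + c)"
proof
  show "T a b ` line c \<subseteq> line (a + c)" by (auto simp: line_def add.commute)
  have "pt (a + c) y = T a b (pt c (y + b + \<sigma> a * c))" for y by (simp add: add_ac)
  then show "line (a + c) \<subseteq> T a b ` line c"
    unfolding line_def using T_Infty[of a b]
    by (metis (no_types, lifting) image_insert image_subsetI insert_iff insert_subset rangeI
        rev_image_eqI)
qed

lemma M_line [simp]: 
  assumes "k \<noteq> 0" shows "M k ` line c = line (k * c)"
proof
  show "M k ` line c \<subseteq> line (k * c)" by (auto simp: line_def)
  have "pt (k * c) y = M k (pt c (y / (\<sigma> k * k)))" for y using assms by simp
  then show "line (k * c) \<subseteq> M k ` line c"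
    unfolding line_def using M_Infty[of k]
    by (metis (no_types, lifting) image_insert image_subsetI insert_iff insert_subset rangeI
        rev_image_eqI)
qed

lemma Omega_base: "(Infty, L) \<in> \<Omega>"
proof -
  have "(Infty, L) = flag_act (\<lambda>x\<in>V. x) (Infty, L)"
    by (simp only: flag_act_pair sz.image_id[OF line_subset] restrict_apply' Infty_in)
  then show ?thesis unfolding \<Omega>_def using sz.id_in by blast
qed

lemma Omega_cases [consumes 1]:
  assumes "(x, N) \<in> \<Omega>" obtains g where "g \<in> Sz" "x = g Infty" "N = g ` L"
  using assms by (auto simp: \<Omega>_def)

lemma Omega_flag:
  assumes "(x, N) \<in> \<Omega>"
  shows "x \<in> V" "N \<subseteq> V" "x \<in> N" "card N = q + 1" "finite N"
proof -
  obtain g where g: "g \<in> Sz" "x = g Infty" "N = g ` L" using assms by (rule Omega_cases)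
  show "x \<in> V" "x \<in> N" "N \<subseteq> V"
    using g sz.maps[OF g(1)] line_in_V by auto
  show "card N = q + 1"
    using g card_image[OF inj_on_subset[OF sz.inj[OF g(1)] line_subset]] by (simp add: card_line)
  then show "finite N" by (metis card.infinite Suc_eq_plus1 Zero_not_Suc)
qed

lemma Omega_act:
  assumes "g \<in> Sz" "(x, N) \<in> \<Omega>" shows "(g x, g ` N) \<in> \<Omega>"
proof -
  obtain h where h: "h \<in> Sz" "x = h Infty" "N = h ` L" using assms(2) by (rule Omega_cases)
  then have "(g x, g ` N) = flag_act (compose V g h) (Infty, L)"
    by (simp add: sz.image_compose compose_eq)
  then show ?thesis unfolding \<Omega>_def using sz.compose_in[OF assms(1) h(1)] by blast
qed

lemma Omega_act_iff:
  assumes "g \<in> Sz" "x \<in> V" "N \<subseteq> V" shows "(g x, g ` N) \<in> \<Omega> \<longleftrightarrow> (x, N) \<in> \<Omega>"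
proof
  obtain h where h: "h \<in> Sz" "\<And>x. x \<in> V \<Longrightarrow> h (g x) = x" using sz.inverse[OF assms(1)] by metis
  assume "(g x, g ` N) \<in> \<Omega>"
  then have "(h (g x), h ` g ` N) \<in> \<Omega>" by (rule Omega_act[OF h(1)])
  then show "(x, N) \<in> \<Omega>" using assms h(2) by (simp add: sz.image_inverse)
qed (rule Omega_act[OF assms(1)])

text \<open>
  An element fixing \<open>\<infinity>\<close> differs by a translation from one that also fixes the origin. The
  latter is a scaling and so stabilizes \<open>L\<close>; only the translate of \<open>L\<close> matters.
\<close>

lemma flags_at_Infty: "(Infty, N) \<in> \<Omega> \<longleftrightarrow> (\<exists>a. N = line a)"
proof
  assume "(Infty, N) \<in> \<Omega>"
  then obtain g where g: "g \<in> Sz" "Infty = g Infty" "N = g ` L" by (rule Omega_cases)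
  have "g (pt 0 0) \<noteq> Infty" using sz.eq_iff[OF g(1), of "pt 0 0" Infty] g(2) by auto
  then obtain a b where ab: "g (pt 0 0) = pt a b" using sz.maps[OF g(1) pt_in] by (metis V_cases)
  let ?t = "T a (b + \<sigma> a * a)"
  have "compose V ?t g \<in> Sz" "compose V ?t g Infty = Infty" "compose V ?t g (pt 0 0) = pt 0 0"
    using sz.compose_in[OF T_in_Sz g(1)] g(2) ab by (simp_all add: compose_eq add_ac)
  then obtain k where k: "k \<noteq> 0" "compose V ?t g = M k" by (rule two_point_stabilizer)
  have "?t ` N = compose V ?t g ` L" by (simp add: g(3) sz.image_compose)
  also have "\<dots> = L" using k by simp
  finally have "T a b ` ?t ` N = line a" by simp
  moreover have "T a b ` ?t ` N = N"
  proof (rule sz.image_inverse)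
    show "N \<subseteq> V" using g sz.image_subset by simp
    show "T a b (?t x) = x" if "x \<in> V" for x using that by (rule T_cancel)
  qed
  ultimately show "\<exists>a. N = line a" by auto
next
  assume "\<exists>a. N = line a"
  then obtain a where "N = line a" by blast
  then show "(Infty, N) \<in> \<Omega>" using Omega_act[OF T_in_Sz[of a 0] Omega_base] by simp
qed

text \<open>
  By 2-transitivity it is enough to look at \<open>\<infinity>\<close> and the origin, and the sets \<open>line a\<close> partition the
  affine points.
\<close>

lemma flag_through_unique:
  assumes "x \<in> V" "y \<in> V" "x \<noteq> y"
  shows "\<exists>!N. (x, N) \<in> \<Omega> \<and> y \<in> N"
proof -
  obtain g where g: "g \<in> Sz" "g Infty = x" "g (pt 0 0) = y" using assms by (rule Sz_from_base)
  obtain h where h: "h \<in> Sz" "\<And>z. z \<in> V \<Longrightarrow> h (g z) = z" "\<And>z. z \<in> V \<Longrightarrow> g (h z) = z"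
    using sz.inverse[OF g(1)] by metis
  show ?thesis
  proof (rule ex1I)
    show "(x, g ` L) \<in> \<Omega> \<and> y \<in> g ` L"
      using Omega_act[OF g(1) Omega_base] g by auto
  next
    fix N assume N: "(x, N) \<in> \<Omega> \<and> y \<in> N"
    then have "(h x, h ` N) \<in> \<Omega>" using Omega_act[OF h(1)] by blast
    moreover have "h x = Infty" "h y = pt 0 0" using g h(2) by auto
    ultimately obtain a where a: "h ` N = line a" using flags_at_Infty by auto
    have "pt 0 0 \<in> h ` N" using N \<open>h y = pt 0 0\<close> by force
    then have "h ` N = L" using a by simp
    moreover have "g ` h ` N = N" using N Omega_flag h(3) by (metis sz.image_inverse)
    ultimately show "N = g ` L" by simp
  qed
qed

lemma flags_meet_in_point:
  assumes "(x, N) \<in> \<Omega>" "(x, N') \<in> \<Omega>" "N \<noteq> N'" shows "N \<inter> N' = {x}"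
proof -
  have "y = x" if "y \<in> N \<inter> N'" for y
    using that assms flag_through_unique[of x y] Omega_flag(1,2) by blast
  then show ?thesis using assms Omega_flag(3) by blast
qed

lemma finite_Omega: "finite \<Omega>"
proof (rule finite_subset)
  show "\<Omega> \<subseteq> V \<times> Pow V" using Omega_flag(1,2) by fast
qed simp

lemma card_flags_at:
  assumes "x \<in> V" shows "card (flags_at \<Omega> x) = q"
proof -
  obtain y where "y \<in> V" "y \<noteq> x" by (metis Infty_in pt_in pt_not_Infty(1))
  then obtain g where g: "g \<in> Sz" "g Infty = x" using assms by (metis Sz_from_base)
  obtain h where h: "h \<in> Sz" "\<And>z. z \<in> V \<Longrightarrow> h (g z) = z" "\<And>z. z \<in> V \<Longrightarrow> g (h z) = z"
    using sz.inverse[OF g(1)] by metis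
  have "flags_at \<Omega> x = range (\<lambda>a. (x, g ` line a))"
  proof
    show "range (\<lambda>a. (x, g ` line a)) \<subseteq> flags_at \<Omega> x"
      using Omega_act[OF g(1)] flags_at_Infty g(2) by (auto simp: flags_at_def)
    show "flags_at \<Omega> x \<subseteq> range (\<lambda>a. (x, g ` line a))"
    proof
      fix f assume "f \<in> flags_at \<Omega> x"
      then obtain N where f: "f = (x, N)" and N: "(x, N) \<in> \<Omega>"
        by (cases f) (auto simp: flags_at_def)
      have "(Infty, h ` N) \<in> \<Omega>" using Omega_act[OF h(1) N] h(2) g(2) by force
      then obtain a where "h ` N = line a" using flags_at_Infty by auto
      moreover have "g ` h ` N = N" using N Omega_flag h(3) by (metis sz.image_inverse)
      ultimately show "f \<in> range (\<lambda>a. (x, g ` line a))" using f by auto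
    qed
  qed
  moreover have "inj (\<lambda>a. (x, g ` line a))"
    using inj_on_image_eq_iff[OF sz.inj[OF g(1)] line_subset line_subset] by (auto intro: injI)
  ultimately show ?thesis by (simp add: card_image card_UNIV)
qed

lemma card_Omega: "card \<Omega> = q * (q ^ 2 + 1)"
proof -
  have "\<Omega> = (\<Union>x\<in>V. flags_at \<Omega> x)"
    using Omega_flag(1) by (auto simp: flags_at_def)
  also have "card \<dots> = (\<Sum>x\<in>V. card (flags_at \<Omega> x))"
    by (rule card_UN_disjoint) (auto simp: flags_at_def finite_Omega)
  also have "\<dots> = q * (q ^ 2 + 1)" by (simp add: card_flags_at card_points)
  finally show ?thesis .
qed

text \<open>
  Applying \<open>w\<close>, the block \<open>w L\<close> would be some \<open>line a\<close>; but the first coordinates \<open>y / \<sigma> y\<close> of its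
  affine points are not all equal.
\<close>

lemma flag_point_of_L: "(pt 0 0, L) \<notin> \<Omega>"
proof
  assume "(pt 0 0, L) \<in> \<Omega>"
  then have "(Infty, W ` L) \<in> \<Omega>" using Omega_act[OF W_in_Sz] by force
  then obtain a where a: "W ` L = line a" using flags_at_Infty by auto
  have W: "W (pt 0 y) = pt (y / \<sigma> y) 0" if "y \<noteq> 0" for y
    using that W_pt[of 0 y] by (simp add: nrm_def)
  have "y / \<sigma> y = a" if "y \<noteq> 0" for y
    using a W[OF that] by (metis imageI pt_in_line)
  then have "\<sigma> y = y" if "y \<noteq> 0" for y
    using that by (metis divide_eq_1_iff div_self one_neq_zero sigma_1)
  then show False by (metis sigma_fixed third_element)
qed

lemma flag_point_unique:
  assumes "(x, N) \<in> \<Omega>" "(y, N) \<in> \<Omega>" shows "x = y"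
proof (rule ccontr)
  assume "x \<noteq> y"
  moreover have "x \<in> V" "y \<in> V" "y \<in> N" using assms Omega_flag by auto
  ultimately obtain g where g: "g \<in> Sz" "g Infty = x" "g (pt 0 0) = y" by (metis Sz_from_base)
  have "(x, g ` L) \<in> \<Omega>" "y \<in> g ` L" using Omega_act[OF g(1) Omega_base] g by auto
  then have "N = g ` L"
    using flag_through_unique[of x y] assms(1) \<open>x \<noteq> y\<close> \<open>x \<in> V\<close> \<open>y \<in> V\<close> \<open>y \<in> N\<close> by blast
  then have "(g (pt 0 0), g ` L) \<in> \<Omega>" using assms(2) g(3) by simp
  then show False using Omega_act_iff[OF g(1)] flag_point_of_L by simp
qed

section \<open>The blocks and the design\<close>

definition \<B> :: "'a sz_point set set" where "\<B> = snd ` \<Omega>"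

lemma blocks_cases: assumes "B \<in> \<B>" obtains g where "g \<in> Sz" "B = g ` L"
  using assms by (auto simp: \<B>_def \<Omega>_def)

lemma image_block: "g \<in> Sz \<Longrightarrow> B \<in> \<B> \<Longrightarrow> g ` B \<in> \<B>"
  unfolding \<B>_def using Omega_act by (metis (no_types, lifting) image_iff prod.collapse snd_conv)

lemma block_props:
  assumes "B \<in> \<B>" shows "B \<subseteq> V" "card B = q + 1" "finite B"
proof -
  obtain x where "(x, B) \<in> \<Omega>" using assms by (auto simp: \<B>_def)
  then show "B \<subseteq> V" "card B = q + 1" "finite B" by (blast dest: Omega_flag)+
qed

lemma finite_blocks: "finite \<B>"
  by (simp add: \<B>_def finite_Omega)

lemma card_blocks: "card \<B> = q * (q ^ 2 + 1)"
proof -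
  have "inj_on snd \<Omega>" using flag_point_unique by (auto intro!: inj_onI)
  then show ?thesis by (simp add: \<B>_def card_image card_Omega)
qed

lemma blocks_through_invariant:
  assumes "g \<in> Sz" "x \<in> V" "y \<in> V"
  shows "card {B \<in> \<B>. g x \<in> B \<and> g y \<in> B} = card {B \<in> \<B>. x \<in> B \<and> y \<in> B}"
proof -
  have "{B \<in> \<B>. g x \<in> B \<and> g y \<in> B} = (`) g ` {B \<in> \<B>. x \<in> B \<and> y \<in> B}"
  proof
    show "(`) g ` {B \<in> \<B>. x \<in> B \<and> y \<in> B} \<subseteq> {B \<in> \<B>. g x \<in> B \<and> g y \<in> B}"
      using image_block[OF assms(1)] by auto
    show "{B \<in> \<B>. g x \<in> B \<and> g y \<in> B} \<subseteq> (`) g ` {B \<in> \<B>. x \<in> B \<and> y \<in> B}"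
    proof
      fix B assume B: "B \<in> {B \<in> \<B>. g x \<in> B \<and> g y \<in> B}"
      obtain h where h: "h \<in> Sz" "\<And>z. z \<in> V \<Longrightarrow> h (g z) = z" "\<And>z. z \<in> V \<Longrightarrow> g (h z) = z"
        using sz.inverse[OF assms(1)] by metis
      have "x \<in> h ` B" "y \<in> h ` B"
        using B imageI[of "g x" B h] imageI[of "g y" B h] h(2) assms(2,3) by simp_all
      moreover have "g ` h ` B = B"
        by (rule sz.image_inverse) (use B h(3) block_props in auto)
      moreover have "h ` B \<in> \<B>" using B image_block[OF h(1)] by blast
      ultimately show "B \<in> (`) g ` {B \<in> \<B>. x \<in> B \<and> y \<in> B}"
        by (intro image_eqI[of _ _ "h ` B"]) auto
    qed
  qed
  moreover have "inj_on ((`) g) {B \<in> \<B>. x \<in> B \<and> y \<in> B}"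
    using inj_on_image_eq_iff[OF sz.inj[OF assms(1)]] block_props(1)
    by (intro inj_onI) blast
  ultimately show ?thesis by (simp add: card_image)
qed

text \<open>
  The number of blocks through two points does not depend on the points by 2-transitivity, so
  it is found by counting the triples of an ordered pair of distinct points and a block
  containing both.
\<close>

lemma card_blocks_through:
  assumes "x \<in> V" "y \<in> V" "x \<noteq> y"
  shows "card {B \<in> \<B>. x \<in> B \<and> y \<in> B} = q + 1"
proof -
  let ?r = "card {B \<in> \<B>. x \<in> B \<and> y \<in> B}"
  let ?S = "{(x, y). x \<in> V \<and> y \<in> V \<and> x \<noteq> y}"
  have finS: "finite ?S" by (rule finite_subset[of _ "V \<times> V"]) auto
  have "(\<Sum>i\<in>?S. card {B \<in> \<B>. fst i \<in> B \<and> snd i \<in> B}) = (q + 1) * q * card \<B>"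
  proof (rule sum_multicount[OF finS finite_blocks], rule ballI)
    fix B assume B: "B \<in> \<B>"
    have "{i \<in> ?S. fst i \<in> B \<and> snd i \<in> B} = {(x, y). x \<in> B \<and> y \<in> B \<and> x \<noteq> y}"
      using block_props(1)[OF B] by auto
    then show "card {i \<in> ?S. fst i \<in> B \<and> snd i \<in> B} = (q + 1) * q"
      using card_off_diagonal[OF block_props(3)[OF B]] block_props(2)[OF B] by simp
  qed
  moreover have "card {B \<in> \<B>. fst i \<in> B \<and> snd i \<in> B} = ?r" if i: "i \<in> ?S" for i
  proof -
    obtain g where "g \<in> Sz" "g x = fst i" "g y = snd i"
      using two_transitive_Sz assms i unfolding two_transitive_on_def by fastforce
    then show ?thesis using blocks_through_invariant[of g x y] assms by simp
  qed
  ultimately have "card ?S * ?r = (q + 1) * q * card \<B>" by simp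
  then have "((q ^ 2 + 1) * q ^ 2) * ?r = ((q ^ 2 + 1) * q ^ 2) * (q + 1)"
    unfolding card_off_diagonal[OF finite_V] card_points card_blocks
    by (simp add: power2_eq_square algebra_simps)
  then show ?thesis using q_ge_2 by (simp only: mult_cancel1) simp
qed

end

lemma Xi_iff: "(f, f') \<in> Xi A \<longleftrightarrow>
    f \<in> A \<and> f' \<in> A \<and> fst f \<noteq> fst f' \<and> fst f \<in> snd f \<inter> snd f' \<and> fst f' \<in> snd f \<inter> snd f'"
  by (cases f; cases f') (auto simp: Xi_def)

lemma sym_Xi: "sym (Xi A)"
  by (rule symI) (auto simp: Xi_iff)

context suzuki_field
begin

abbreviation \<D> :: "'a sz_point incidence_structure" where
  "\<D> \<equiv> \<lparr>points = V, blocks = \<B>\<rparr>"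

lemma two_design_D: "two_design \<D> (q ^ 2 + 1) (q + 1) (q + 1)"
  unfolding two_design_def using block_props card_blocks_through by (simp add: card_points)

lemma base_arc: "((Infty, L), (pt 0 0, W ` L)) \<in> Xi \<Omega>"
proof -
  have "Infty \<in> W ` L" by (rule image_eqI[of _ _ "pt 0 0"]) simp_all
  moreover have "(pt 0 0, W ` L) \<in> \<Omega>" using Omega_act[OF W_in_Sz Omega_base] by simp
  moreover from this have "pt 0 0 \<in> W ` L" by (rule Omega_flag)
  ultimately show ?thesis using Omega_base by (simp add: Xi_iff)
qed

end

section \<open>Groups containing the Suzuki group\<close>

text \<open>
  The assumption \<open>stabilizes_L\<close> is what remains of the hypothesis that \<open>P\<close> is a block for the stabilizer
  of \<open>\<infinity>\<close> in \<open>H\<close>, once \<open>P\<close> is known. Both \<open>G\<close> and the Suzuki group itself are instances.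
\<close>

locale suzuki_overgroup = suzuki_field e \<sigma> + grp: permutation_subgroup "sz_points e" H
  for e and \<sigma> :: "'a::{field, finite} \<Rightarrow> 'a" and H +
  assumes Sz_subset: "Sz \<subseteq> H"
    and stabilizes_L: "\<And>g. g \<in> H \<Longrightarrow> g Infty = Infty \<Longrightarrow> g (pt 0 0) = pt 0 0 \<Longrightarrow> g ` L = L"
begin

abbreviation X :: "('a sz_point \<Rightarrow> 'a sz_point) monoid" where "X \<equiv> perm_group V H"

lemma Sz_H: "g \<in> Sz \<Longrightarrow> g \<in> H"
  using Sz_subset by blast

text \<open>
  The reason why \<open>H\<close> and the Suzuki group have the same orbits on flags and blocks.
\<close>

lemma agrees_with_Sz:
  assumes "g \<in> H"
  obtains s where "s \<in> Sz" "g Infty = s Infty" "g ` L = s ` L"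
proof -
  have "g Infty \<in> V" "g (pt 0 0) \<in> V" "g Infty \<noteq> g (pt 0 0)"
    using assms grp.maps by auto
  then obtain s where s: "s \<in> Sz" "s Infty = g Infty" "s (pt 0 0) = g (pt 0 0)"
    by (rule Sz_from_base)
  obtain i where i: "i \<in> Sz" "\<And>z. z \<in> V \<Longrightarrow> i (s z) = z" "\<And>z. z \<in> V \<Longrightarrow> s (i z) = z"
    using sz.inverse[OF s(1)] by metis
  have "compose V i g ` L = L"
    by (rule stabilizes_L[OF grp.compose_in[OF Sz_H[OF i(1)] assms]])
      (use i(2)[of Infty] i(2)[of "pt 0 0"] s in \<open>simp_all add: compose_eq\<close>)
  then have "s ` i ` g ` L = s ` L" by (simp add: grp.image_compose)
  moreover have "s ` i ` g ` L = g ` L"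
    by (rule sz.image_inverse) (use i(3) grp.image_subset[OF assms line_subset] in auto)
  ultimately show ?thesis using s that by simp
qed

lemma H_Omega_act:
  assumes "g \<in> H" "(x, N) \<in> \<Omega>" shows "(g x, g ` N) \<in> \<Omega>"
proof -
  obtain s where s: "s \<in> Sz" "x = s Infty" "N = s ` L" using assms(2) by (rule Omega_cases)
  obtain t where t: "t \<in> Sz" "compose V g s Infty = t Infty" "compose V g s ` L = t ` L"
    using grp.compose_in[OF assms(1) Sz_H[OF s(1)]] by (rule agrees_with_Sz)
  then have "g x = t Infty" "g ` N = t ` L"
    using s by (simp_all add: compose_eq grp.image_compose)
  then show ?thesis using Omega_act[OF t(1) Omega_base] by simp
qed

lemma H_image_block: "g \<in> H \<Longrightarrow> B \<in> \<B> \<Longrightarrow> g ` B \<in> \<B>"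
  unfolding \<B>_def using H_Omega_act by (metis (no_types, lifting) image_iff prod.collapse snd_conv)

lemma orbit_flag: "orbit X flag_act (Infty, L) = \<Omega>"
proof
  show "orbit X flag_act (Infty, L) \<subseteq> \<Omega>"
    using H_Omega_act[OF _ Omega_base] by (auto simp: orbit_def)
  show "\<Omega> \<subseteq> orbit X flag_act (Infty, L)"
    using Sz_H by (auto simp: orbit_def \<Omega>_def)
qed

lemma orbit_block: "orbit X (\<lambda>g S. g ` S) L = \<B>"
proof
  have "L \<in> \<B>" unfolding \<B>_def using Omega_base by force
  then show "orbit X (\<lambda>g S. g ` S) L \<subseteq> \<B>"
    using H_image_block by (auto simp: orbit_def)
  show "\<B> \<subseteq> orbit X (\<lambda>g S. g ` S) L"
  proof
    fix B assume "B \<in> \<B>"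
    then obtain g where "g \<in> Sz" "B = g ` L" by (rule blocks_cases)
    then show "B \<in> orbit X (\<lambda>g S. g ` S) L" using Sz_H by (auto simp: orbit_def)
  qed
qed

lemma automorphisms_D: "H \<subseteq> automorphisms \<D>"
proof
  fix g assume g: "g \<in> H"
  obtain h where h: "h \<in> H" "\<And>z. z \<in> V \<Longrightarrow> h (g z) = z" "\<And>z. z \<in> V \<Longrightarrow> g (h z) = z"
    using grp.inverse[OF g] by metis
  have "B \<in> (`) g ` \<B>" if B: "B \<in> \<B>" for B
  proof (rule image_eqI)
    show "h ` B \<in> \<B>" by (rule H_image_block[OF h(1) B])
    show "B = g ` h ` B"
      by (rule grp.image_inverse[symmetric]) (use h(3) block_props[OF B] in auto)
  qed
  then have "(`) g ` \<B> = \<B>" using H_image_block[OF g] by blast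
  then show "g \<in> automorphisms \<D>"
    using grp.in_Bij[OF g] by (simp add: automorphisms_def)
qed

lemma two_transitive_H: "two_transitive_on H V"
  using two_transitive_Sz Sz_H unfolding two_transitive_on_def by blast

lemma block_transitive_H: "block_transitive H \<D>"
  unfolding block_transitive_def
proof (intro ballI)
  fix B C assume "B \<in> blocks \<D>" "C \<in> blocks \<D>"
  then obtain g h where g: "g \<in> Sz" "B = g ` L" and h: "h \<in> Sz" "C = h ` L"
    by (auto elim!: blocks_cases)
  obtain i where i: "i \<in> Sz" "\<And>z. z \<in> V \<Longrightarrow> i (g z) = z" using sz.inverse[OF g(1)] by metis
  have "i ` B = L" unfolding g(2) by (rule sz.image_inverse) (use i(2) in auto)
  moreover have "B \<subseteq> V" unfolding g(2) using sz.image_subset[OF g(1) line_subset] .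
  ultimately have "compose V h i ` B = C" using h(2) by (simp add: sz.image_compose)
  then show "\<exists>g\<in>H. g ` B = C" using Sz_H sz.compose_in[OF h(1) i(1)] by blast
qed

text \<open>
  For \<open>(\<infinity>, L)\<close> the translations \<open>T 0 b\<close> act transitively on the affine points of \<open>L\<close>; any other flag
  is dealt with by conjugation.
\<close>

lemma flag_stabilizer_transitive:
  assumes "(x, N) \<in> \<Omega>"
  shows "transitive_on (point_set_stabilizer X x N) (N - {x})"
  unfolding transitive_on_def
proof (intro ballI)
  fix y z assume y: "y \<in> N - {x}" and z: "z \<in> N - {x}"
  obtain g where g: "g \<in> Sz" "x = g Infty" "N = g ` L" using assms by (rule Omega_cases)
  obtain h where h: "h \<in> Sz" "\<And>z. z \<in> V \<Longrightarrow> h (g z) = z" "\<And>z. z \<in> V \<Longrightarrow> g (h z) = z"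
    using sz.inverse[OF g(1)] by metis
  have affine: "\<exists>b. w = g (pt 0 b)" if "w \<in> N - {x}" for w
    using that g by (auto simp: line_def)
  obtain b c where b: "y = g (pt 0 b)" and c: "z = g (pt 0 c)" using affine y z by blast
  let ?k = "compose V g (compose V (T 0 (b + c)) h)"
  have k: "?k \<in> Sz" by (intro sz.compose_in g h T_in_Sz)
  have k_eq: "?k p = g (T 0 (b + c) (h p))" if "p \<in> V" for p
    using that by (simp add: compose_eq)
  have kg: "?k (g p) = g (T 0 (b + c) p)" if "p \<in> V" for p
    using k_eq[OF sz.maps[OF g(1) that]] h(2)[OF that] by simp
  have "?k x = x" using kg[of Infty] g(2) by simp
  moreover have "?k y = z" using kg[of "pt 0 b"] b c by simp
  moreover have "?k ` N = N"
  proof -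
    have "?k ` N = (\<lambda>p. g (T 0 (b + c) p)) ` L"
      unfolding g(3) image_image by (rule image_cong[OF refl kg[OF line_in_V]])
    also have "\<dots> = g ` T 0 (b + c) ` L" by (simp only: image_image)
    finally show ?thesis by (simp add: g(3))
  qed
  ultimately show "\<exists>k\<in>point_set_stabilizer X x N. k y = z"
    using Sz_H[OF k]
    by (intro bexI[of _ ?k]) (simp_all add: point_set_stabilizer_def point_stabilizer_def stabilizer_def)
qed

lemma one_feasible_Omega: "one_feasible X \<D> \<Omega>"
  unfolding one_feasible_def
proof (intro conjI)
  have "(Infty, L) \<in> flags \<D>" using Omega_base by (force simp: flags_def \<B>_def)
  then show "\<Omega> \<in> orbits X (flags \<D>) flag_act"
    unfolding orbits_def using orbit_flag by blast
  show "\<forall>x\<in>points \<D>. card (flags_at \<Omega> x) \<ge> 2" using q_ge_2 by (simp add: card_flags_at)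
  show "\<forall>(x, N)\<in>\<Omega>. transitive_on (point_set_stabilizer X x N) (N - {x})"
    using flag_stabilizer_transitive by blast
  show "\<forall>x N N'. (x, N) \<in> \<Omega> \<longrightarrow> (x, N') \<in> \<Omega> \<longrightarrow> N \<noteq> N' \<longrightarrow> N \<inter> N' = {x}"
    using flags_meet_in_point by blast
qed

text \<open>
  By \<open>flag_through_unique\<close> an arc is determined by the two point entries of its flags, so this is
  2-transitivity on points.
\<close>

lemma Xi_orbit: "Xi \<Omega> = orbit X flag_pair_act ((Infty, L), (pt 0 0, W ` L))"
proof
  have "(pt 0 0, W ` L) \<in> \<Omega>" "Infty \<in> W ` L" "pt 0 0 \<in> W ` L"
    using base_arc by (simp_all add: Xi_iff)
  then have "flag_pair_act g ((Infty, L), (pt 0 0, W ` L)) \<in> Xi \<Omega>" if "g \<in> H" for g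
    using that H_Omega_act[OF that] Omega_base by (auto simp: flag_pair_act_def Xi_iff)
  then show "orbit X flag_pair_act ((Infty, L), (pt 0 0, W ` L)) \<subseteq> Xi \<Omega>"
    by (auto simp: orbit_def)
  show "Xi \<Omega> \<subseteq> orbit X flag_pair_act ((Infty, L), (pt 0 0, W ` L))"
  proof
    fix a assume "a \<in> Xi \<Omega>"
    then obtain x N y N' where a: "a = ((x, N), (y, N'))"
      and xN: "(x, N) \<in> \<Omega>" "y \<in> N" and yN': "(y, N') \<in> \<Omega>" "x \<in> N'" and "x \<noteq> y"
      by (auto simp: Xi_def)
    have V: "x \<in> V" "y \<in> V" using xN yN' Omega_flag by auto
    obtain g where g: "g \<in> Sz" "g Infty = x" "g (pt 0 0) = y"
      using V \<open>x \<noteq> y\<close> by (rule Sz_from_base)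
    have 1: "(x, g ` L) \<in> \<Omega>" "y \<in> g ` L"
      using Omega_act[OF g(1) Omega_base] g by auto
    have 2: "(y, g ` W ` L) \<in> \<Omega>" "x \<in> g ` W ` L"
      using Omega_act[OF g(1) \<open>(pt 0 0, W ` L) \<in> \<Omega>\<close>] \<open>Infty \<in> W ` L\<close> g by auto
    have "N = g ` L" using flag_through_unique[OF V \<open>x \<noteq> y\<close>] xN 1 by blast
    moreover have "N' = g ` W ` L" using flag_through_unique[of y x] V \<open>x \<noteq> y\<close> yN' 2 by blast
    ultimately have "a = flag_pair_act g ((Infty, L), (pt 0 0, W ` L))"
      using a g by (simp add: flag_pair_act_def)
    then show "a \<in> orbit X flag_pair_act ((Infty, L), (pt 0 0, W ` L))"
      using Sz_H[OF g(1)] by (auto simp: orbit_def)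
  qed
qed

lemma is_flag_graph_Omega:
  "is_flag_graph X \<D> \<Omega> (Xi \<Omega>) \<lparr>pverts = \<Omega>, parcs = Xi \<Omega>\<rparr>"
proof -
  have "((Infty, L), (pt 0 0, W ` L)) \<in> \<Omega> \<times> \<Omega>"
    using Omega_base Omega_act[OF W_in_Sz Omega_base] by simp
  then have "Xi \<Omega> \<in> orbits X (\<Omega> \<times> \<Omega>) flag_pair_act"
    unfolding orbits_def using Xi_orbit by blast
  then show ?thesis
    by (simp add: is_flag_graph_def one_feasible_Omega sym_Xi)
qed

end

section \<open>Blocks of imprimitivity of the stabilizer of \<open>\<infinity>\<close>\<close>

context suzuki_field
begin

sublocale over_Sz: suzuki_overgroup e \<sigma> Sz
proof unfold_locales
  fix g assume "g \<in> Sz" "g Infty = Infty" "g (pt 0 0) = pt 0 0"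
  then obtain k where "k \<noteq> 0" "g = M k" by (rule two_point_stabilizer)
  then show "g ` L = L" by simp
qed simp

lemma block_invariant:
  assumes block: "imprimitive_block (point_stabilizer (perm_group V H) Infty) S P"
    and "g \<in> H" "g Infty = Infty" "p \<in> P" "g p \<in> P"
  shows "g ` P = P"
proof -
  have "g \<in> point_stabilizer (perm_group V H) Infty"
    using assms by (simp add: point_stabilizer_def stabilizer_def)
  moreover have "g ` P \<inter> P \<noteq> {}" using assms by blast
  ultimately show ?thesis using block unfolding imprimitive_block_def by blast
qed

text \<open>
  Identifying \<open>pt a b\<close> with \<open>T a b\<close>, blocks through the origin are subgroups of the translation
  group that are invariant under the scalings.
\<close>

lemma block_is_axis:
  assumes "Sz \<subseteq> H"
    and block: "nontrivial_imprimitive_block (point_stabilizer (perm_group V H) Infty) (V - {Infty}) P"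
    and zero: "pt 0 0 \<in> P"
  shows "P = range (pt 0)"
proof -
  have imp: "imprimitive_block (point_stabilizer (perm_group V H) Infty) (V - {Infty}) P"
    and card_P: "1 < card P" "card P < card (V - {Infty})"
    using block by (auto simp: nontrivial_imprimitive_block_def)
  have "P \<subseteq> V - {Infty}" using imp by (simp add: imprimitive_block_def)
  then have P_pt: "\<exists>x y. p = pt x y" if "p \<in> P" for p using that by (metis V_cases Diff_iff insertI1 subsetD)
  have T_P: "T a b p \<in> P" if "pt a b \<in> P" "p \<in> P" for a b p
  proof -
    have "T a b ` P = P"
      by (rule block_invariant[OF imp _ _ zero]) (use that T_in_Sz assms(1) in auto)
    then show ?thesis using that by blast
  qed
  have M_P: "M k p \<in> P" if "k \<noteq> 0" "p \<in> P" for k p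
  proof -
    have "M k ` P = P"
      by (rule block_invariant[OF imp _ _ zero]) (use that zero M_in_Sz assms(1) in auto)
    then show ?thesis using that by blast
  qed
  have axis: "range (pt 0) \<subseteq> P" if "pt 0 b \<in> P" "b \<noteq> 0" for b
  proof safe
    fix y
    show "pt 0 y \<in> P"
    proof (cases "y = 0")
      case False
      obtain k where k: "\<sigma> k * k = y / b" "y / b \<noteq> 0 \<Longrightarrow> k \<noteq> 0"
        using sigma_plus_one_root[of "y / b"] by blast
      have "k \<noteq> 0" using k(2) False that(2) by simp
      from M_P[OF this that(1)] show ?thesis using k(1) that(2) by simp
    qed (use zero in simp)
  qed
  have "x = 0" if xy: "pt x y \<in> P" for x y
  proof (rule ccontr)
    assume "x \<noteq> 0"
    \<comment> \<open>the square of the translation \<open>T x y\<close>\<close>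
    have "pt 0 (\<sigma> x * x) \<in> P" using T_P[OF xy xy] by simp
    then have "range (pt 0) \<subseteq> P" using \<open>x \<noteq> 0\<close> by (intro axis[of "\<sigma> x * x"]) auto
    have "V - {Infty} \<subseteq> P"
    proof
      fix p assume "p \<in> V - {Infty}"
      then obtain a b where p: "p = pt a b" by (auto elim: V_cases)
      show "p \<in> P"
      proof (cases "a = 0")
        case True
        then show ?thesis using p \<open>range (pt 0) \<subseteq> P\<close> by auto
      next
        case False
        define k where "k = a / x"
        have k: "k \<noteq> 0" "k * x = a" using False \<open>x \<noteq> 0\<close> by (simp_all add: k_def)
        have "pt a (\<sigma> k * k * y) \<in> P" using M_P[OF k(1) xy] k(2) by simp
        moreover have "pt 0 (\<sigma> k * k * y + b) \<in> P" using \<open>range (pt 0) \<subseteq> P\<close> by auto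
        ultimately have "T 0 (\<sigma> k * k * y + b) (pt a (\<sigma> k * k * y)) \<in> P" using T_P by blast
        then show ?thesis by (simp add: p)
      qed
    qed
    then have "card (V - {Infty}) \<le> card P"
      using \<open>P \<subseteq> V - {Infty}\<close> finite_V by (metis card_mono finite_Diff finite_subset)
    then show False using card_P by simp
  qed
  then have "P \<subseteq> range (pt 0)" using P_pt by blast
  have "P \<noteq> {pt 0 0}" using card_P by auto
  then obtain p where "p \<in> P" "p \<noteq> pt 0 0" using zero by blast
  then obtain b where "pt 0 b \<in> P" "b \<noteq> 0" using \<open>P \<subseteq> range (pt 0)\<close> by auto
  then show ?thesis using axis \<open>P \<subseteq> range (pt 0)\<close> by blast
qed

lemma axis_stabilizer:
  "point_set_stabilizer (perm_group V Sz) Infty (range (pt 0)) =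
     generate (BijGroup V) ({T 0 b | b. True} \<union> {M k | k. k \<noteq> 0})" (is "?S = generate _ ?A")
proof
  have gen: "?A \<subseteq> carrier (BijGroup V)" 
    using T_in_Bij M_in_Bij by (auto simp: BijGroup_def)
  interpret K: permutation_subgroup V "generate (BijGroup V) ?A"
    by (rule permutation_subgroup.intro group.generate_is_subgroup group_BijGroup gen)+
  show "?S \<subseteq> generate (BijGroup V) ?A"
  proof
    fix g assume "g \<in> ?S"
    then have g: "g \<in> Sz" "g Infty = Infty" "g ` range (pt 0) = range (pt 0)"
      by (auto simp: point_set_stabilizer_def point_stabilizer_def stabilizer_def)
    then obtain b where b: "g (pt 0 0) = pt 0 b" by blast
    have "compose V (T 0 b) g \<in> Sz" "compose V (T 0 b) g Infty = Infty"
      "compose V (T 0 b) g (pt 0 0) = pt 0 0"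
      using sz.compose_in[OF T_in_Sz g(1)] g(2) b by (simp_all add: compose_eq)
    then obtain k where k: "k \<noteq> 0" "compose V (T 0 b) g = M k" by (rule two_point_stabilizer)
    have "compose V (T 0 b) (compose V (T 0 b) g) \<in> generate (BijGroup V) ?A"
      unfolding k(2) using k(1) by (intro K.compose_in generate.incl) auto
    moreover have "compose V (T 0 b) (compose V (T 0 b) g) = g"
    proof (rule extensionalityI)
      show "compose V (T 0 b) (compose V (T 0 b) g) \<in> extensional V" "g \<in> extensional V"
        using sz.in_Bij[OF g(1)] by (auto simp: Bij_def)
      fix p assume "p \<in> V"
      then show "compose V (T 0 b) (compose V (T 0 b) g) p = g p"
        using sz.maps[OF g(1)] by (simp add: compose_eq T_0_cancel)
    qed
    ultimately show "g \<in> generate (BijGroup V) ?A" by simp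
  qed
  show "generate (BijGroup V) ?A \<subseteq> ?S"
  proof (rule group.generate_subgroup_incl[OF group_BijGroup])
    have axis: "g ` range (pt 0) = range (pt 0)" if "g \<in> Sz" "g ` range (pt 0) \<subseteq> range (pt 0)" for g
    proof (rule endo_inj_surj[OF _ that(2)])
      have "range (pt 0) \<subseteq> V" by auto
      then show "inj_on g (range (pt 0))" by (rule inj_on_subset[OF sz.inj[OF that(1)]])
    qed simp
    have "T 0 b ` range (pt 0) = range (pt 0)" for b by (rule axis[OF T_in_Sz]) auto
    moreover have "M k ` range (pt 0) = range (pt 0)" if "k \<noteq> 0" for k
      by (rule axis[OF M_in_Sz[OF that]]) auto
    ultimately show "?A \<subseteq> ?S"
      using T_in_Sz M_in_Sz
      unfolding point_set_stabilizer_def point_stabilizer_def stabilizer_def by auto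
    show "subgroup ?S (BijGroup V)"
      by (rule sz.subgroup_point_set_stabilizer) auto
  qed
qed

end

section \<open>Connectedness and valency of the flag graph\<close>

context suzuki_field
begin

text \<open>
  The affine points fall into the \<open>q\<close> classes of equal first coordinate, which are the orbits of
  the automorphisms \<open>T 0 b\<close>. A point \<open>x\<close> off the axis has at most one neighbour in each class: if \<open>p\<close>
  and \<open>p'\<close> were two, the involution \<open>T 0 b\<close> interchanging them would map \<open>x\<close> to a second common
  neighbour of \<open>p\<close> and \<open>p'\<close>, a quadrangle. As \<open>x\<close> has \<open>q\<close> neighbours, it has exactly one in each class.

  Now let \<open>x = pt 1 0\<close> and take the class of some \<open>c \<noteq> 0, 1\<close>. Each of the \<open>q\<close> neighbours of \<open>x\<close> has a
  neighbour in this class, and these are distinct because there are no quadrangles; so they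
  exhaust the class. But the class also contains a neighbour of \<open>x\<close>, which gives a triangle.
\<close>

lemma no_Moore_relation:
  assumes R_V: "\<And>x y. R x y \<Longrightarrow> y \<in> V"
    and sym: "\<And>x y. R x y \<Longrightarrow> R y x"
    and degree: "\<And>x. x \<in> V \<Longrightarrow> card {y. R x y} = q"
    and triangle_free: "\<And>x y z. R x y \<Longrightarrow> R y z \<Longrightarrow> \<not> R x z"
    and quad_free: "\<And>x y y' z. R x y \<Longrightarrow> R y z \<Longrightarrow> R x y' \<Longrightarrow> R y' z \<Longrightarrow> x \<noteq> z \<Longrightarrow> y = y'"
    and shift: "\<And>x y b. R x y \<Longrightarrow> R (T 0 b x) (T 0 b y)"
    and at_Infty: "\<And>y. R Infty y \<Longrightarrow> y \<in> range (pt 0)"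
    and at_axis: "\<And>m b. m \<noteq> 0 \<Longrightarrow> R (pt 0 b) (pt m b)"
  shows False
proof -
  have class_unique: "b = b'" if "m \<noteq> 0" "R (pt m d) (pt a b)" "R (pt m d) (pt a b')" for m d a b b'
  proof (rule ccontr)
    assume "b \<noteq> b'"
    then have "pt m d \<noteq> T 0 (b + b') (pt m d)"
      by (metis T_pt add_0_right add_cancel_left_right add_eq_0_char2 mult_zero_left pt_eq sigma_0)
    moreover have "R (pt a b') (T 0 (b + b') (pt m d))" "R (pt a b) (T 0 (b + b') (pt m d))"
      using shift[OF that(2), of "b + b'"] shift[OF that(3), of "b + b'"]
      by (simp_all add: sym add_ac)
    ultimately have "pt a b = pt a b'" using that(2,3) quad_free by blast
    then show False using \<open>b \<noteq> b'\<close> by simp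
  qed
  have class_exists: "\<exists>b. R (pt m d) (pt a b)" if "a \<noteq> 0" for m d a
  proof (cases "m = 0")
    case True
    then show ?thesis using at_axis[OF that] by blast
  next
    case False
    let ?N = "{y. R (pt m d) y}"
    have "\<exists>a b. y = pt a b" if "y \<in> ?N" for y
    proof -
      have "y \<noteq> Infty" using that at_Infty[of "pt m d"] sym False by fastforce
      then show ?thesis using R_V that by (metis V_cases mem_Collect_eq)
    qed
    then obtain f h where fh: "\<And>y. y \<in> ?N \<Longrightarrow> y = pt (f y) (h y)" by metis
    have "inj_on f ?N"
    proof (rule inj_onI)
      fix y z assume yz: "y \<in> ?N" "z \<in> ?N" "f y = f z"
      then have "R (pt m d) (pt (f y) (h y))" "R (pt m d) (pt (f y) (h z))"
        using fh by (metis mem_Collect_eq)+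
      then have "h y = h z" by (rule class_unique[OF False])
      then show "y = z" using yz fh by metis
    qed
    then have "card (f ` ?N) = card (UNIV :: 'a set)"
      using degree[of "pt m d"] by (simp add: card_image card_UNIV)
    then have "f ` ?N = UNIV" by (intro card_subset_eq) auto
    then obtain y where "y \<in> ?N" "a = f y" by blast
    then show ?thesis using fh by (metis mem_Collect_eq)
  qed
  obtain c :: 'a where c: "c \<noteq> 0" "c \<noteq> 1" by (rule third_element)
  let ?x = "pt 1 0" and ?A = "{y. R (pt 1 0) y}"
  have "\<exists>b. R y (pt c b)" if "y \<in> ?A" for y
  proof -
    have "y \<noteq> Infty" using that at_Infty[of ?x] sym by fastforce
    then obtain a d where "y = pt a d" using R_V \<open>y \<in> ?A\<close> by (metis V_cases mem_Collect_eq)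
    then show ?thesis using class_exists[OF c(1)] by blast
  qed
  then obtain g where g: "\<And>y. y \<in> ?A \<Longrightarrow> R y (pt c (g y))" by metis
  have "inj_on g ?A"
  proof (rule inj_onI)
    fix y z assume yz: "y \<in> ?A" "z \<in> ?A" "g y = g z"
    have "?x \<noteq> pt c (g y)" using c(2) by auto
    moreover have "R ?x y" "R y (pt c (g y))" "R ?x z" "R z (pt c (g y))"
      using yz g[of y] g[of z] by simp_all
    ultimately show "y = z" using quad_free by blast
  qed
  then have "card (g ` ?A) = card (UNIV :: 'a set)"
    using degree[of ?x] by (simp add: card_image card_UNIV)
  then have "g ` ?A = UNIV" by (intro card_subset_eq) auto
  obtain b where b: "R ?x (pt c b)" using class_exists[OF c(1)] by blast
  obtain y where "y \<in> ?A" "b = g y" using \<open>g ` ?A = UNIV\<close> by blast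
  then have "R ?x y" "R y (pt c b)" using g[of y] by simp_all
  then show False using triangle_free b by blast
qed

lemma flag_act_compose:
  assumes "f \<in> \<Omega>" shows "flag_act (compose V g h) f = flag_act g (flag_act h f)"
  using assms Omega_flag(1,2) by (cases f) (simp add: compose_eq sz.image_compose)

lemma Xi_act:
  assumes "g \<in> Sz" "(f, f') \<in> Xi \<Omega>" shows "(flag_act g f, flag_act g f') \<in> Xi \<Omega>"
proof -
  obtain x N y N' where f: "f = (x, N)" "f' = (y, N')" by (metis surj_pair)
  have "(x, N) \<in> \<Omega>" "(y, N') \<in> \<Omega>" using assms(2) f by (auto simp: Xi_iff)
  then have "g x = g y \<longleftrightarrow> x = y" by (intro sz.eq_iff[OF assms(1)] Omega_flag(1))
  then show ?thesis
    using assms Omega_act[OF assms(1)] unfolding f Xi_iff by simp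
qed

definition component :: "'a sz_point flag set" where
  "component = {f. ((Infty, L), f) \<in> (Xi \<Omega>)\<^sup>*}"

lemma component_base: "(Infty, L) \<in> component"
  by (simp add: component_def)

lemma component_step: "f \<in> component \<Longrightarrow> (f, f') \<in> Xi \<Omega> \<Longrightarrow> f' \<in> component"
  by (auto simp: component_def)

lemma component_subset: "component \<subseteq> \<Omega>"
proof
  fix f assume "f \<in> component"
  then have "((Infty, L), f) \<in> (Xi \<Omega>)\<^sup>*" by (simp add: component_def)
  then show "f \<in> \<Omega>" by (induction rule: rtrancl_induct) (auto simp: Xi_iff Omega_base)
qed

lemma Xi_rtrancl_act:
  assumes "g \<in> Sz" "(f, f') \<in> (Xi \<Omega>)\<^sup>*"
  shows "(flag_act g f, flag_act g f') \<in> (Xi \<Omega>)\<^sup>*"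
  using assms(2)
  by (induction rule: rtrancl_induct) (auto intro: rtrancl_into_rtrancl Xi_act[OF assms(1)])

text \<open>
  The stabilizer of the component of \<open>(\<infinity>, L)\<close> in the Suzuki group: automorphisms permute components,
  so it suffices to test one flag.
\<close>

definition K :: "('a sz_point \<Rightarrow> 'a sz_point) set" where
  "K = {g \<in> Sz. flag_act g (Infty, L) \<in> component}"

lemma K_Sz: "g \<in> K \<Longrightarrow> g \<in> Sz"
  by (simp add: K_def)

lemma K_act: assumes "g \<in> K" "f \<in> component" shows "flag_act g f \<in> component"
  using assms Xi_rtrancl_act[of g "(Infty, L)" f] unfolding K_def component_def
  by (blast intro: rtrancl_trans)

lemma K_compose: assumes "g \<in> K" "h \<in> K" shows "compose V g h \<in> K"
proof -
  have "flag_act (compose V g h) (Infty, L) \<in> component"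
    unfolding flag_act_compose[OF Omega_base] using assms K_act unfolding K_def by blast
  then show ?thesis using sz.compose_in[OF K_Sz K_Sz] assms unfolding K_def by blast
qed

lemma K_inverse:
  assumes "g \<in> K"
  obtains h where "h \<in> K" "\<And>x. x \<in> V \<Longrightarrow> h (g x) = x" "\<And>x. x \<in> V \<Longrightarrow> g (h x) = x"
proof -
  obtain h where h: "h \<in> Sz" "\<And>x. x \<in> V \<Longrightarrow> h (g x) = x" "\<And>x. x \<in> V \<Longrightarrow> g (h x) = x"
    using sz.inverse[OF K_Sz[OF assms]] by metis
  have "((Infty, L), flag_act g (Infty, L)) \<in> (Xi \<Omega>)\<^sup>*"
    using assms by (simp add: K_def component_def)
  then have "(flag_act h (Infty, L), flag_act h (flag_act g (Infty, L))) \<in> (Xi \<Omega>)\<^sup>*"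
    by (rule Xi_rtrancl_act[OF h(1)])
  moreover have "flag_act h (flag_act g (Infty, L)) = (Infty, L)"
    using h(2) by (simp add: sz.image_inverse)
  ultimately have "((Infty, L), flag_act h (Infty, L)) \<in> (Xi \<Omega>)\<^sup>*"
    using sym_rtrancl[OF sym_Xi] by (metis symD)
  then show ?thesis using that h by (simp add: K_def component_def)
qed

lemma T_in_K: "T 0 b \<in> K" and M_in_K: "k \<noteq> 0 \<Longrightarrow> M k \<in> K"
  using component_base T_in_Sz M_in_Sz by (simp_all add: K_def)

lemma W_in_K: "W \<in> K"
proof -
  show ?thesis
    using component_step[OF component_base base_arc] W_in_Sz by (simp add: K_def)
qed

text \<open>
  The points \<open>pt m 0\<close> with \<open>m \<noteq> 0\<close> are the images under \<open>w\<close> of the points \<open>pt 0 y\<close> with \<open>y \<noteq> 0\<close>; solving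
  \<open>y / \<sigma> y = m\<close> uses again that \<open>\<sigma> + 1\<close> and \<open>\<sigma> - 1\<close> are inverse exponents.
\<close>

lemma W_axis: "m \<noteq> 0 \<Longrightarrow> W (pt 0 (1 / (\<sigma> m * m))) = pt m 0"
  by (simp add: W_pt nrm_def field_simps power2_eq_square)

lemma K_transitive: assumes "x \<in> V" obtains g where "g \<in> K" "g Infty = x"
  using assms
proof (cases x rule: V_cases)
  case Infty
  then show ?thesis using that[of "T 0 0"] T_in_K by simp
next
  case (pt m b)
  show ?thesis
  proof (cases "m = 0")
    case True
    show ?thesis
      by (rule that[OF K_compose[OF T_in_K[of b] W_in_K]]) (simp add: pt True compose_eq)
  next
    case False
    show ?thesis
      by (rule that[OF K_compose[OF K_compose[OF T_in_K[of b] W_in_K]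
              K_compose[OF T_in_K[of "1 / (\<sigma> m * m)"] W_in_K]]])
        (simp add: pt W_axis[OF False] compose_eq)
  qed
qed

text \<open>
  Moving \<open>x\<close> to \<open>\<infinity>\<close>, the component contains \<open>(\<infinity>, line c)\<close> with \<open>c \<noteq> 0\<close>, and the scalings take \<open>c\<close> to every
  nonzero element; transitivity on points carries this to all other points.
\<close>

lemma component_full:
  assumes "(x, N) \<in> component" "(x, N') \<in> component" "N \<noteq> N'"
  shows "component = \<Omega>"
proof (rule antisym[OF component_subset], rule subsetI)
  have N: "x \<in> V" "N \<subseteq> V" "N' \<subseteq> V" using assms component_subset Omega_flag by blast+
  obtain g where g: "g \<in> K" "g Infty = x" using N(1) by (rule K_transitive)
  obtain h where h: "h \<in> K" "\<And>x. x \<in> V \<Longrightarrow> h (g x) = x" "\<And>x. x \<in> V \<Longrightarrow> g (h x) = x"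
    using K_inverse[OF g(1)] by metis
  have "(Infty, h ` N) \<in> component" "(Infty, h ` N') \<in> component"
    using K_act[OF h(1) assms(1)] K_act[OF h(1) assms(2)] h(2)[of Infty] g(2) by simp_all
  moreover have "h ` N \<noteq> h ` N'"
    using inj_on_image_eq_iff[OF sz.inj[OF K_Sz[OF h(1)]] N(2,3)] assms(3) by simp
  ultimately obtain c where c: "c \<noteq> 0" "(Infty, line c) \<in> component"
    using component_subset flags_at_Infty by (metis subsetD)
  have lines: "(Infty, line a) \<in> component" for a
  proof (cases "a = 0")
    case False
    then show ?thesis using K_act[OF M_in_K[of "a / c"] c(2)] c(1) by simp
  qed (use component_base in simp)
  fix f assume f: "f \<in> \<Omega>"
  then obtain y A where yA: "f = (y, A)" "(y, A) \<in> \<Omega>" "y \<in> V" "A \<subseteq> V"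
    using Omega_flag by (metis surj_pair)
  obtain g where g: "g \<in> K" "g Infty = y" using yA(3) by (rule K_transitive)
  obtain h where h: "h \<in> K" "\<And>x. x \<in> V \<Longrightarrow> h (g x) = x" "\<And>x. x \<in> V \<Longrightarrow> g (h x) = x"
    using K_inverse[OF g(1)] by metis
  have "(Infty, h ` A) \<in> \<Omega>"
    using Omega_act[OF K_Sz[OF h(1)] yA(2)] h(2)[of Infty] g(2) by simp
  then obtain a where "h ` A = line a" using flags_at_Infty by auto
  then have "flag_act g (Infty, h ` A) \<in> component" using K_act[OF g(1) lines] by simp
  moreover have "g ` h ` A = A"
    by (rule sz.image_inverse) (use yA h(3) in auto)
  ultimately show "f \<in> component" using yA(1) g(2) by simp
qed

text \<open>
  If the component has only one flag at each point, it defines the relation \<open>R\<close> below. All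
  properties needed for \<open>no_Moore_relation\<close> can be checked at \<open>x = \<infinity>\<close>, where the neighbours are
  the points \<open>pt 0 b\<close>, and the neighbours of \<open>pt 0 b\<close> other than \<open>\<infinity>\<close> are the points \<open>pt m b\<close>.
\<close>

lemma component_eq_Omega: "component = \<Omega>"
proof (rule ccontr)
  assume "component \<noteq> \<Omega>"
  then have unique: "N = N'" if "(x, N) \<in> component" "(x, N') \<in> component" for x N N'
    using component_full that by blast
  define R where "R x y \<longleftrightarrow> (\<exists>N. (x, N) \<in> component \<and> y \<in> N) \<and> x \<noteq> y" for x y
  have component_at: "\<exists>N. (x, N) \<in> component" if x: "x \<in> V" for x
  proof -
    obtain g where "g \<in> K" "g Infty = x" using x by (rule K_transitive)
    then show ?thesis using K_act[OF _ component_base] by force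
  qed
  have R_V: "x \<in> V" "y \<in> V" if "R x y" for x y
    using that component_subset Omega_flag(1,2) unfolding R_def by blast+
  have R_sym: "R y x" if xy: "R x y" for x y
  proof -
    obtain N where N: "(x, N) \<in> component" "y \<in> N" "x \<noteq> y" using xy by (auto simp: R_def)
    obtain N' where N': "(y, N') \<in> \<Omega>" "x \<in> N'"
      using flag_through_unique[of y x] R_V[OF xy] N(3) by blast
    have "((x, N), (y, N')) \<in> Xi \<Omega>"
      using N N' component_subset Omega_flag(3) by (auto simp: Xi_iff)
    then have "(y, N') \<in> component" using component_step N(1) by blast
    then show ?thesis using N' N(3) by (auto simp: R_def)
  qed
  have R_act: "R (g x) (g y)" if g: "g \<in> K" and xy: "R x y" for g x y
  proof -
    obtain N where N: "(x, N) \<in> component" "y \<in> N" "x \<noteq> y" using xy by (auto simp: R_def)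
    then have "(g x, g ` N) \<in> component" using K_act[OF g N(1)] by simp
    then show ?thesis using N sz.eq_iff[OF K_Sz[OF g] R_V[OF xy]] by (auto simp: R_def)
  qed
  have to_Infty: "\<exists>h\<in>K. h x = Infty" if x: "x \<in> V" for x
  proof -
    obtain g where g: "g \<in> K" "g Infty = x" using x by (rule K_transitive)
    obtain h where "h \<in> K" "\<And>x. x \<in> V \<Longrightarrow> h (g x) = x" using K_inverse[OF g(1)] by metis
    then show ?thesis using g(2) by force
  qed
  have at_Infty: "R Infty y \<longleftrightarrow> y \<in> range (pt 0)" for y
    using unique[OF component_base] component_base by (auto simp: R_def line_def)
  have at_0: "R (pt 0 0) y \<longleftrightarrow> y = Infty \<or> (\<exists>m. m \<noteq> 0 \<and> y = pt m 0)" for y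
  proof
    assume "R (pt 0 0) y"
    from R_act[OF W_in_K this] obtain b where b: "W y = pt 0 b" using at_Infty by auto
    have "y = W (pt 0 b)" using b R_V[OF \<open>R (pt 0 0) y\<close>] by (metis W_W)
    then show "y = Infty \<or> (\<exists>m. m \<noteq> 0 \<and> y = pt m 0)"
      by (cases "b = 0") (auto simp: W_pt nrm_def)
  next
    assume "y = Infty \<or> (\<exists>m. m \<noteq> 0 \<and> y = pt m 0)"
    then obtain b where b: "y = W (pt 0 b)" using W_0 W_axis by metis
    have "R Infty (pt 0 b)" using at_Infty by simp
    from R_act[OF W_in_K this] show "R (pt 0 0) y" by (simp add: b)
  qed
  have at_axis: "R (pt 0 b) y \<longleftrightarrow> y = Infty \<or> (\<exists>m. m \<noteq> 0 \<and> y = pt m b)" for b y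
  proof
    assume R: "R (pt 0 b) y"
    from R_act[OF T_in_K[of b] this] have "T 0 b y = Infty \<or> (\<exists>m. m \<noteq> 0 \<and> T 0 b y = pt m 0)"
      by (simp add: at_0)
    then show "y = Infty \<or> (\<exists>m. m \<noteq> 0 \<and> y = pt m b)"
      using T_0_cancel[OF R_V(2)[OF R], of b] by auto
  next
    assume y: "y = Infty \<or> (\<exists>m. m \<noteq> 0 \<and> y = pt m b)"
    then have "R (pt 0 0) (T 0 b y)" by (auto simp: at_0)
    from R_act[OF T_in_K[of b] this] show "R (pt 0 b) y" using y by auto
  qed
  have degree: "card {y. R x y} = q" if x: "x \<in> V" for x
  proof -
    obtain N where N: "(x, N) \<in> component" using component_at[OF x] by blast
    then have NO: "(x, N) \<in> \<Omega>" using component_subset by blast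
    have "R x y \<longleftrightarrow> y \<in> N \<and> x \<noteq> y" for y using N unique unfolding R_def by metis
    then have "{y. R x y} = N - {x}" by auto
    then show ?thesis using Omega_flag(3,4,5)[OF NO] by simp
  qed
  show False
  proof (rule no_Moore_relation[of R])
    fix x y z assume R: "R x y" "R y z"
    show "\<not> R x z"
    proof
      assume xz: "R x z"
      obtain h where h: "h \<in> K" "h x = Infty" using to_Infty R_V(1)[OF R(1)] by blast
      obtain b c where "h y = pt 0 b" "h z = pt 0 c"
        using R_act[OF h(1) R(1)] R_act[OF h(1) xz] h(2) at_Infty by auto
      then show False using R_act[OF h(1) R(2)] at_axis by auto
    qed
  next
    fix x y y' z assume R: "R x y" "R y z" "R x y'" "R y' z" and "x \<noteq> z"
    obtain h where h: "h \<in> K" "h x = Infty" using to_Infty R_V(1)[OF R(1)] by blast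
    note eq = sz.eq_iff[OF K_Sz[OF h(1)]]
    obtain b c where bc: "h y = pt 0 b" "h y' = pt 0 c"
      using R_act[OF h(1) R(1)] R_act[OF h(1) R(3)] h(2) at_Infty by auto
    have "h z \<noteq> Infty" using eq[OF R_V(1)[OF R(1)] R_V(2)[OF R(2)]] h(2) \<open>x \<noteq> z\<close> by auto
    then have "b = c" using R_act[OF h(1) R(2)] R_act[OF h(1) R(4)] bc at_axis by auto
    then show "y = y'" using bc eq[OF R_V(2)[OF R(1)] R_V(2)[OF R(3)]] by simp
  qed (use R_V R_sym degree R_act[OF T_in_K] at_Infty at_axis in auto)
qed

lemma flag_graph_connected: "connected (with_proj \<lparr>pverts = \<Omega>, parcs = Xi \<Omega>\<rparr>)"
proof -
  let ?G = "\<lparr>pverts = \<Omega>, parcs = Xi \<Omega>\<rparr>"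
  have sub: "Xi \<Omega> \<subseteq> \<Omega> \<times> \<Omega>" by (auto simp: Xi_iff)
  have "parcs (mk_symmetric (with_proj ?G)) = Xi \<Omega>"
    using symD[OF sym_Xi, of _ _ \<Omega>] by (auto simp: mk_symmetric_def)
  then have arcs: "arcs_ends (with_proj (mk_symmetric (with_proj ?G))) = Xi \<Omega>"
    by (auto simp: arcs_ends_def arc_to_ends_def)
  have "(f, f') \<in> rtrancl_on \<Omega> (Xi \<Omega>)" if "f \<in> \<Omega>" "f' \<in> \<Omega>" for f f'
  proof -
    have base: "((Infty, L), f) \<in> (Xi \<Omega>)\<^sup>*" if "f \<in> \<Omega>" for f
      using component_eq_Omega that by (auto simp: component_def)
    have "(f, (Infty, L)) \<in> (Xi \<Omega>)\<^sup>*"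
      using base[OF that(1)] sym_rtrancl[OF sym_Xi] by (metis symD)
    then have "(f, f') \<in> (Xi \<Omega>)\<^sup>*" using base[OF that(2)] by (rule rtrancl_trans)
    then show ?thesis
      by (induction rule: rtrancl_induct)
        (use that sub in \<open>auto intro: rtrancl_on_into_rtrancl_on\<close>)
  qed
  then show ?thesis
    unfolding connected_def strongly_connected_def reachable_def arcs
    using Omega_base by (auto simp: mk_symmetric_def)
qed

lemma flag_graph_valency: "has_valency \<lparr>pverts = \<Omega>, parcs = Xi \<Omega>\<rparr> q"
  unfolding has_valency_def
proof (intro conjI ballI)
  let ?G = "\<lparr>pverts = \<Omega>, parcs = Xi \<Omega>\<rparr>"
  have sub: "Xi \<Omega> \<subseteq> \<Omega> \<times> \<Omega>" by (auto simp: Xi_iff)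
  show "pair_graph ?G"
  proof
    show "finite (pverts ?G)" by (simp add: finite_Omega)
    show "finite (parcs ?G)" using finite_subset[OF sub] by (simp add: finite_Omega)
    show "symmetric (with_proj ?G)"
      using sym_Xi[of \<Omega>] by (simp add: symmetric_def)
  qed (use sub in \<open>auto simp: Xi_iff\<close>)
  fix f assume "f \<in> pverts ?G"
  then obtain x N where f: "f = (x, N)" and xN: "(x, N) \<in> \<Omega>" by (cases f) auto
  have "out_arcs (with_proj ?G) f = {f} \<times> {f'. (f, f') \<in> Xi \<Omega>}"
    by (auto simp: out_arcs_def)
  then have "out_degree (with_proj ?G) f = card {f'. (f, f') \<in> Xi \<Omega>}"
    by (simp add: out_degree_def card_cartesian_product)
  also have "\<dots> = card (N - {x})"
  proof (rule bij_betw_same_card[of fst])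
    show "bij_betw fst {f'. (f, f') \<in> Xi \<Omega>} (N - {x})"
      unfolding bij_betw_def
    proof
      show "inj_on fst {f'. (f, f') \<in> Xi \<Omega>}"
      proof (rule inj_onI)
        fix u v assume uv: "u \<in> {f'. (f, f') \<in> Xi \<Omega>}" "v \<in> {f'. (f, f') \<in> Xi \<Omega>}" "fst u = fst v"
        obtain y A B where eq: "u = (y, A)" "v = (y, B)" using uv(3) by (cases u; cases v) auto
        then have "(y, A) \<in> \<Omega>" "(y, B) \<in> \<Omega>" "x \<in> A" "x \<in> B" "y \<noteq> x"
          using uv f by (auto simp: Xi_iff)
        then show "u = v"
          using flag_through_unique[of y x] Omega_flag(1) xN eq by blast
      qed
      show "fst ` {f'. (f, f') \<in> Xi \<Omega>} = N - {x}"
      proof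
        show "fst ` {f'. (f, f') \<in> Xi \<Omega>} \<subseteq> N - {x}" by (auto simp: Xi_iff f)
        show "N - {x} \<subseteq> fst ` {f'. (f, f') \<in> Xi \<Omega>}"
        proof
          fix y assume y: "y \<in> N - {x}"
          then obtain A where A: "(y, A) \<in> \<Omega>" "x \<in> A"
            using flag_through_unique[of y x] Omega_flag(1,2)[OF xN] by blast
          then have "(f, (y, A)) \<in> Xi \<Omega>"
            using y xN f Omega_flag(3) by (auto simp: Xi_iff)
          then show "y \<in> fst ` {f'. (f, f') \<in> Xi \<Omega>}" by force
        qed
      qed
    qed
  qed
  also have "\<dots> = q" using Omega_flag(3,4,5)[OF xN] by simp
  finally show "out_degree (with_proj ?G) f = q" .
qed

end

section \<open>The theorem\<close>

theorem lemma3p4: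
  fixes e q :: nat
    and G :: "('a::{field, finite} sz_point \<Rightarrow> 'a sz_point) set"
    and P :: "'a sz_point set"
  assumes "q = 2 ^ (2 * e + 1)" and "q > 2" and "card (UNIV :: 'a set) = q"
    and "subgroup G (BijGroup (sz_points e))"
    and "suzuki e \<lhd> perm_group (sz_points e) G"
    and "nontrivial_imprimitive_block
           (point_stabilizer (perm_group (sz_points e) G) Infty) (sz_points e - {Infty}) P"
    and "Aff 0 0 0 \<in> P"
  shows
    "let V = sz_points e;
         Sz = perm_group V (suzuki e);
         X = perm_group V G;
         L = P \<union> {Infty};
         D = \<lparr>points = V, blocks = orbit Sz (\<lambda>g S. g ` S) L\<rparr>;
         \<Omega> = orbit Sz flag_act (Infty, L);
         \<Xi> = Xi \<Omega>;
         \<Gamma> = \<lparr>pverts = \<Omega>, parcs = \<Xi>\<rparr>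
     in
       \<comment> \<open>(a)\<close>
       P = {p \<in> V. \<exists>\<eta>. p = Aff 0 \<eta> (sig e \<eta>)} \<and>
       point_set_stabilizer Sz Infty P =
         generate (BijGroup V) ({sz_t e 0 \<xi> | \<xi>. True} \<union> {sz_n e \<kappa> | \<kappa>. \<kappa> \<noteq> 0}) \<and>
       \<comment> \<open>(b)\<close>
       D = \<lparr>points = V, blocks = orbit X (\<lambda>g S. g ` S) L\<rparr> \<and>
       two_design D (q^2 + 1) (q + 1) (q + 1) \<and>
       G \<subseteq> automorphisms D \<and> two_transitive_on G V \<and> block_transitive G D \<and>
       \<Omega> = orbit X flag_act (Infty, L) \<and>
       one_feasible X D \<Omega> \<and>
       is_flag_graph X D \<Omega> \<Xi> \<Gamma> \<and> is_flag_graph Sz D \<Omega> \<Xi> \<Gamma> \<and>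
       \<comment> \<open>(c)\<close>
       connected (with_proj \<Gamma>) \<and>
       card (pverts \<Gamma>) = q * (q^2 + 1) \<and>
       has_valency \<Gamma> q"
proof -
  have "0 < e" using assms(1,2) by (cases e) auto
  then interpret F: suzuki_field e "sig e :: 'a \<Rightarrow> 'a"
    using assms(1,3) by unfold_locales auto
  have q: "q = F.q" using assms(1) by (simp add: F.q_def)
  have Sz_G: "suzuki e \<subseteq> G"
    using subgroup.subset[OF normal_imp_subgroup[OF assms(5)]] by simp
  have zero: "F.pt 0 0 \<in> P" using assms(7) by (simp add: F.pt_0)
  have P: "P = range (F.pt 0)" by (rule F.block_is_axis[OF Sz_G assms(6) zero])
  then have L: "P \<union> {Infty} = F.L" by (simp add: F.line_def)
  interpret G: suzuki_overgroup e "sig e :: 'a \<Rightarrow> 'a" G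
  proof (intro suzuki_overgroup.intro permutation_subgroup.intro suzuki_overgroup_axioms.intro)
    show "suzuki_field e (sig e :: 'a \<Rightarrow> 'a)" by (rule F.suzuki_field_axioms)
    show "subgroup G (BijGroup (sz_points e))" by (rule assms(4))
    show "suzuki e \<subseteq> G" by (rule Sz_G)
    fix g assume g: "g \<in> G" "g Infty = Infty" "g (F.pt 0 0) = F.pt 0 0"
    have "g ` P = P"
      by (rule F.block_invariant[of G _ P g "F.pt 0 0"])
        (use assms(6) g zero in \<open>auto simp: nontrivial_imprimitive_block_def\<close>)
    then show "g ` F.L = F.L" using g(2) by (simp add: L[symmetric])
  qed
  have P_eq: "P = {p \<in> sz_points e. \<exists>\<eta>. p = Aff 0 \<eta> (sig e \<eta>)}"
  proof -
    have "F.pt 0 \<eta> = Aff 0 \<eta> (sig e \<eta>)" for \<eta> by (simp add: F.pt_def F.nrm_def)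
    then show ?thesis using F.pt_in[of 0] by (auto simp: P)
  qed
  show ?thesis
    unfolding Let_def L F.over_Sz.orbit_flag F.over_Sz.orbit_block G.orbit_flag G.orbit_block q
    using P_eq F.axis_stabilizer[folded P] F.two_design_D G.automorphisms_D G.two_transitive_H
      G.block_transitive_H G.one_feasible_Omega G.is_flag_graph_Omega F.over_Sz.is_flag_graph_Omega
      F.flag_graph_connected F.card_Omega F.flag_graph_valency
    by simp
qed

end
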